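(* 1. Let $q(x_1,x_2,\dots,x_n)$ be a $P$-hyperbolic (homogeneous) polynomial of degree $n$. Then $$\frac{\partial^n}{\partial x_1\cdots\partial x_n} q(0,\dots,0)\ \ge\ \frac{n!}{n^n}\,\mathrm{Cap}(q).$$ 2. This bound is attained only on the following class of polynomials: $$q_{a_1,\dots,a_n}(x_1,\dots,x_n)=\left(\frac{\sum_{1\le i\le n} a_i x_i}{n}\right)^{n},\qquad a_i>0,\ 1\le i\le n.$$ (Notice that $\mathrm{Cap}(q_{a_1,\dots,a_n})=\prod_{1\le i\le n} a_i$.)
   Context: A homogeneous real polynomial $p(x)$, $x\in\mathbb{R}^m$, of degree $n$ is called hyperbolic in the direction $e\in\mathbb{R}^m$ (or $e$-hyperbolic) if for every $x\in\mathbb{R}^m$ the polynomial $\lambda\mapsto p(x-\lambda e)$ has exactly $n$ real roots, counted with multiplicity, denoted $\lambda_1(x)\ge\dots\ge\lambda_n(x)$; it is assumed throughout that $p(e)>0$. A vector $x$ is $e$-nonnegative if $\lambda_n(x)\ge 0$. A homogeneous polynomial $p$ of degree $n$ in $n$ real variables is called $P$-hyperbolic if it is hyperbolic in the direction $e=(1,1,\dots,1)$ and its closed cone of $e$-nonnegative vectors contains the nonnegative orthant $\mathbb{R}^n_+=\{(x_1,\dots,x_n): x_i\ge 0,\ 1\le i\le n\}$. The capacity of a homogeneous polynomial $q$ of degree $n$ in $n$ variables is $$\mathrm{Cap}(q)=\inf\Big\{q(x_1,\dots,x_n): x_i>0,\ \prod_{1\le i\le n} x_i=1\Big\}.$$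
   Formalization: Part 2 is stated for Cap(q) > 0 only, since for n ≥ 2 the P-hyperbolic polynomial q = x_1^n has Cap(q) = 0 and zero mixed derivative, so it attains the bound without belonging to the class. *)

theory Defs
  imports "HOL-Analysis.Analysis" "HOL-Computational_Algebra.Computational_Algebra"
begin

text \<open>
  Real polynomials in the variables indexed by \<open>'n\<close> are represented by the functions on
  \<open>real ^ 'n\<close> they induce, which loses nothing because the reals are infinite. The multi-indices
  \<open>\<alpha>\<close> with \<open>sum \<alpha> UNIV = d\<close> are finite in number, so the sum below is a genuine finite sum.
\<close>

definition homogeneous_poly :: "nat \<Rightarrow> (real ^ 'n \<Rightarrow> real) \<Rightarrow> bool" where
  "homogeneous_poly d p \<longleftrightarrow>
     (\<exists>c :: ('n \<Rightarrow> nat) \<Rightarrow> real. \<forall>x.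
        p x = (\<Sum>\<alpha> | sum \<alpha> UNIV = d. c \<alpha> * (\<Prod>i\<in>UNIV. (x $ i) ^ \<alpha> i)))"

text \<open>
  The univariate polynomial \<open>\<lambda> \<mapsto> p (x - \<lambda> e)\<close>; it exists and is unique for polynomial \<open>p\<close>,
  see \<open>poly_line_poly\<close> below.
\<close>

definition line_poly :: "(real ^ 'n \<Rightarrow> real) \<Rightarrow> real ^ 'n \<Rightarrow> real ^ 'n \<Rightarrow> real poly" where
  "line_poly p e x = (THE r. \<forall>t. poly r t = p (x - t *\<^sub>R e))"

lemma poly_line_poly:
  assumes "homogeneous_poly d p"
  shows "poly (line_poly p e x) t = p (x - t *\<^sub>R e)"
proof -
  obtain c :: "('a \<Rightarrow> nat) \<Rightarrow> real" where
    c: "\<And>x. p x = (\<Sum>\<alpha> | sum \<alpha> UNIV = d. c \<alpha> * (\<Prod>i\<in>UNIV. (x $ i) ^ \<alpha> i))"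
    using assms unfolding homogeneous_poly_def by blast
  let ?r = "\<Sum>\<alpha> | sum \<alpha> UNIV = d. [:c \<alpha>:] * (\<Prod>i\<in>UNIV. [:x $ i, - (e $ i):] ^ \<alpha> i)"
  have "\<forall>t. poly ?r t = p (x - t *\<^sub>R e)"
    by (simp add: c poly_sum poly_prod)
  moreover have "r = ?r" if "\<forall>t. poly r t = p (x - t *\<^sub>R e)" for r
    using that calculation by (simp flip: poly_eq_poly_eq_iff add: fun_eq_iff)
  ultimately have "\<forall>t. poly (line_poly p e x) t = p (x - t *\<^sub>R e)"
    unfolding line_poly_def by (rule theI)
  then show ?thesis by blast
qed

definition hyperbolic :: "nat \<Rightarrow> real ^ 'n \<Rightarrow> (real ^ 'n \<Rightarrow> real) \<Rightarrow> bool" where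
  "hyperbolic d e p \<longleftrightarrow>
     homogeneous_poly d p \<and> p e > 0 \<and>
     (\<forall>x. line_poly p e x \<noteq> 0 \<and> size (proots (line_poly p e x)) = d)"

text \<open>The root \<open>\<lambda>\<^sub>i(x)\<close> in \<open>\<lambda>\<^sub>1(x) \<ge> \<dots> \<ge> \<lambda>\<^sub>d(x)\<close>, for \<open>1 \<le> i \<le> d\<close>.\<close>

definition hyp_root :: "real ^ 'n \<Rightarrow> (real ^ 'n \<Rightarrow> real) \<Rightarrow> nat \<Rightarrow> real ^ 'n \<Rightarrow> real" where
  "hyp_root e p i x = rev (sorted_list_of_multiset (proots (line_poly p e x))) ! (i - 1)"

definition nonneg_cone :: "nat \<Rightarrow> real ^ 'n \<Rightarrow> (real ^ 'n \<Rightarrow> real) \<Rightarrow> (real ^ 'n) set" where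
  "nonneg_cone d e p = {x. hyp_root e p d x \<ge> 0}"

definition P_hyperbolic :: "(real ^ 'n \<Rightarrow> real) \<Rightarrow> bool" where
  "P_hyperbolic p \<longleftrightarrow>
     hyperbolic CARD('n) (\<chi> i. 1) p \<and>
     {x. \<forall>i. x $ i \<ge> 0} \<subseteq> nonneg_cone CARD('n) (\<chi> i. 1) p"

text \<open>
  The infimum is a real one. A P-hyperbolic polynomial is nonnegative on the positive orthant,
  so that the set is then bounded below.
\<close>

definition capacity :: "(real ^ 'n \<Rightarrow> real) \<Rightarrow> real" where
  "capacity q = Inf {q x | x. (\<forall>i. x $ i > 0) \<and> (\<Prod>i\<in>UNIV. x $ i) = 1}"

definition partial_deriv :: "'n \<Rightarrow> (real ^ 'n \<Rightarrow> real) \<Rightarrow> real ^ 'n \<Rightarrow> real" where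
  "partial_deriv i f x = deriv (\<lambda>t. f (x + t *\<^sub>R axis i 1)) 0"

definition mixed_partial :: "'n list \<Rightarrow> (real ^ 'n \<Rightarrow> real) \<Rightarrow> real ^ 'n \<Rightarrow> real" where
  "mixed_partial is f = foldr partial_deriv is f"

definition linear_form_power :: "real ^ 'n \<Rightarrow> real ^ 'n \<Rightarrow> real" where
  "linear_form_power a x = ((\<Sum>i\<in>UNIV. a $ i * x $ i) / real CARD('n)) ^ CARD('n)"

end

theory Submission
  imports Defs
begin

text \<open>
  A P-hyperbolic polynomial \<open>q\<close> has no zero at which all variables have positive real part
  (\<open>hyperbolic_imp_hstable\<close>, a case of Garding's theorem). The induction runs over polynomials with
  this property. It rests on passing from a polynomial of degree \<open>k\<close> in \<open>k\<close> variables to its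
  \<^emph>\<open>slice\<close>, the coefficient of the first power of one variable, which is a polynomial of degree
  \<open>k - 1\<close> in the other \<open>k - 1\<close> variables. Slicing by all variables in turn ends at the coefficient of
  \<open>x\<^sub>1 \<cdots> x\<^sub>n\<close>, the mixed partial derivative. A slice that is positive on the positive orthant is stable again
  (\<open>hstable_slice\<close>).

  By homogeneity the capacity is the largest \<open>C\<close> with \<open>q x \<ge> C * x\<^sub>1 \<cdots> x\<^sub>k\<close> on the positive orthant.
  Fix positive values \<open>y\<close> of all variables but one. As a function of the remaining one, \<open>q\<close> has only
  real roots, none of them positive, so if it does not vanish at \<open>0\<close> it is
  \<open>R * (1 + b\<^sub>1 t) \<cdots> (1 + b\<^sub>k t)\<close> with \<open>b\<^sub>j \<ge> 0\<close>; its slope \<open>R * (b\<^sub>1 + \<cdots> + b\<^sub>k)\<close> at \<open>0\<close> is the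
  slice at \<open>y\<close>. The inequality of arithmetic and geometric means, applied to the factors at the right
  \<open>t\<close>, shows that a slice keeps at least the fraction \<open>((k - 1) / k) ^ (k - 1)\<close> of the capacity
  (\<open>slice_capacity\<close>). The product of these factors is \<open>n! / n ^ n\<close>.

  In the case of equality, with positive capacity, every slice attains its bound, so by induction the slice is a power of a
  linear form \<open>\<Sum> a\<^sub>j x\<^sub>j\<close>, and its capacity is attained at \<open>y\<^sub>j = 1 / a\<^sub>j\<close>. Equality of the two
  means there makes all \<open>b\<^sub>j\<close> equal to one \<open>b > 0\<close>: on the plane through \<open>y\<close> and the axis of the sliced
  variable \<open>q\<close> is a power of a linear form. That form vanishes in a direction \<open>v\<close>, and real-rootedness
  forces \<open>q\<close> to be constant along \<open>v\<close> everywhere (\<open>hstable_lineality\<close>). Integrating the known slice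
  along \<open>v\<close> gives \<open>q = A + B * l ^ k\<close> on each line in the sliced direction, with \<open>l\<close> linear, and a
  real-rooted polynomial of this shape has \<open>A = 0\<close> once \<open>k > 2\<close>; for \<open>k = 2\<close> the plane through \<open>y\<close>
  is everything.
\<close>

section \<open>Univariate polynomials and the location of their roots\<close>

lemma complex_poly_eqI_reals:
  fixes p q :: "complex poly"
  assumes "\<And>t::real. poly p (of_real t) = poly q (of_real t)"
  shows "p = q"
proof (rule ccontr)
  assume "p \<noteq> q"
  then have "finite {z. poly (p - q) z = 0}" by (intro poly_roots_finite) simp
  moreover have "range complex_of_real \<subseteq> {z. poly (p - q) z = 0}" using assms by auto
  ultimately have "finite (range complex_of_real)" by (rule finite_subset[rotated])
  then show False
    using finite_imageD[of complex_of_real UNIV] by (simp add: inj_on_def infinite_UNIV_char_0)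
qed

lemma poly_eqI_infinite:
  fixes p q :: "real poly"
  assumes "infinite X" "\<And>t. t \<in> X \<Longrightarrow> poly p t = poly q t"
  shows "p = q"
proof (rule ccontr)
  assume "p \<noteq> q"
  then have "finite {t. poly (p - q) t = 0}" by (intro poly_roots_finite) simp
  moreover have "X \<subseteq> {t. poly (p - q) t = 0}" using assms(2) by auto
  ultimately show False using assms(1) finite_subset by blast
qed

lemma poly_map_of_real: "poly (map_poly of_real p) (of_real t) = complex_of_real (poly p t)"
  by (induction p) (auto simp: map_poly_pCons)

lemma Re_logderiv_linear_factors:
  fixes A :: "complex multiset"
  defines "r \<equiv> \<Prod>a\<in>#A. [:-a, 1:]"
  assumes "\<forall>a\<in>#A. Re a < 0"
  shows "poly r 0 \<noteq> 0 \<and> Re (poly (pderiv r) 0 / poly r 0) \<ge> 0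
    \<and> (A \<noteq> {#} \<longrightarrow> Re (poly (pderiv r) 0 / poly r 0) > 0)"
  using assms(2) unfolding r_def
proof (induction A)
  case empty
  show ?case by simp
next
  case (add a A)
  let ?s = "\<Prod>a\<in>#A. [:-a, 1:]"
  from add have s: "poly ?s 0 \<noteq> 0" "Re (poly (pderiv ?s) 0 / poly ?s 0) \<ge> 0" by auto
  from add.prems have a: "Re a < 0" "a \<noteq> 0" by auto
  have "Re (- (1 / a)) > 0"
    using a by (simp add: Re_divide divide_less_0_iff sum_power2_gt_zero_iff complex_eq_iff)
  moreover have "poly (pderiv ([:-a, 1:] * ?s)) 0 / poly ([:-a, 1:] * ?s) 0
      = poly (pderiv ?s) 0 / poly ?s 0 + - (1 / a)"
    using a s unfolding pderiv_mult by (simp add: pderiv_pCons field_simps)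
  ultimately show ?case using a s by simp
qed

text \<open>
  The logarithmic derivative at \<open>0\<close> is the sum of \<open>- 1 / a\<close> over the roots \<open>a\<close>, and each term has
  positive real part. This is the form of the Gauss--Lucas theorem from which stability of derivatives
  follows.
\<close>

lemma Re_logderiv_pos:
  fixes r :: "complex poly"
  assumes "degree r > 0" "\<And>z. poly r z = 0 \<Longrightarrow> Re z < 0"
  shows "Re (poly (pderiv r) 0 / poly r 0) > 0"
proof -
  let ?r = "\<Prod>a\<in>#proots r. [:-a, 1:]"
  have r0: "r \<noteq> 0" using assms by auto
  have eq: "r = smult (lead_coeff r) ?r" by (simp add: complex_poly_decompose_multiset)
  have "proots r \<noteq> {#}" using size_proots_complex[of r] assms by auto
  then have "Re (poly (pderiv ?r) 0 / poly ?r 0) > 0"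
    using Re_logderiv_linear_factors[of "proots r"] assms r0 by auto
  moreover have "poly (pderiv r) 0 / poly r 0 = poly (pderiv ?r) 0 / poly ?r 0"
    using r0 by (subst (1 2) eq) (simp add: pderiv_smult)
  ultimately show ?thesis by simp
qed

text \<open>
  Each factor satisfies \<open>\<bar>\<i> - a\<bar> \<ge> \<bar>a\<bar>\<close> because its root \<open>a\<close> is real.
\<close>

lemma norm_at_ii_ge:
  fixes r :: "complex poly"
  assumes "r \<noteq> 0" "\<And>z. poly r z = 0 \<Longrightarrow> z \<in> \<real>"
  shows "norm (poly r \<i>) \<ge> norm (poly r 0)"
proof -
  have fac: "norm (\<Prod>a\<in>#A. \<i> - a) \<ge> norm (\<Prod>a\<in>#A. - a)"
    if "\<forall>a\<in>#A. a \<in> \<real>" for A :: "complex multiset"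
    using that
  proof (induction A)
    case (add a A)
    have "norm (\<i> - a) \<ge> norm (- a)"
      using add.prems abs_Re_le_cmod[of "\<i> - a"] by (auto elim!: Reals_cases)
    with add show ?case by (auto simp: norm_mult intro!: mult_mono)
  qed auto
  have ev: "poly r z = lead_coeff r * (\<Prod>a\<in>#proots r. z - a)" for z
    by (subst complex_poly_decompose_multiset[symmetric]) (simp add: poly_prod_mset)
  have "\<forall>a\<in>#proots r. a \<in> \<real>" using assms by simp
  note mult_left_mono[OF fac[OF this] norm_ge_zero[of "lead_coeff r"]]
  moreover have "image_mset ((-) 0) (proots r) = image_mset uminus (proots r)"
    by (rule image_mset_cong) simp
  ultimately show ?thesis unfolding ev norm_mult by (simp only:)
qed

text \<open>
  Every root lies below the real axis, hence at distance at least \<open>Im t\<close> from \<open>t\<close>. The bound is uniform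
  over all such polynomials with the same degree and leading coefficient, which makes it survive limits.
\<close>

lemma norm_poly_ge_Im:
  fixes p :: "complex poly"
  assumes p: "p \<noteq> 0" and roots: "\<And>z. poly p z = 0 \<Longrightarrow> Im z < 0" and t: "Im t \<ge> 0"
  shows "norm (poly p t) \<ge> norm (lead_coeff p) * Im t ^ degree p"
proof -
  have fac: "norm (\<Prod>a\<in>#A. t - a) \<ge> Im t ^ size A" if "\<forall>a\<in>#A. Im a < 0" for A
    using that
  proof (induction A)
    case (add a A)
    have "Im t \<le> norm (t - a)"
      using add.prems abs_Im_le_cmod[of "t - a"] by (auto simp: abs_if split: if_splits)
    with add t show ?case by (auto simp: norm_mult intro!: mult_mono)
  qed simp
  have ev: "poly p t = lead_coeff p * (\<Prod>a\<in>#proots p. t - a)"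
    by (subst complex_poly_decompose_multiset[symmetric]) (simp add: poly_prod_mset)
  have "\<forall>a\<in>#proots p. Im a < 0" using roots p by simp
  from mult_left_mono[OF fac[OF this] norm_ge_zero[of "lead_coeff p"]]
  show ?thesis unfolding ev norm_mult by (simp only: size_proots_complex)
qed

text \<open>
  The numbers \<open>b j\<close> are the negated reciprocals of the roots. They are padded by zeros up to \<open>k\<close>, so
  that the degree of the polynomial, which may drop, never enters later arguments.
\<close>

lemma real_roots_product:
  fixes r :: "complex poly"
  assumes "degree r \<le> k" "poly r 0 \<noteq> 0"
    and "\<And>z. poly r z = 0 \<Longrightarrow> z \<in> \<real>"
  obtains b :: "nat \<Rightarrow> real" where
    "\<And>j. (\<And>z. poly r z = 0 \<Longrightarrow> Re z < 0) \<Longrightarrow> b j \<ge> 0" "\<And>z. poly r z = poly r 0 * (\<Prod>j<k. 1 + of_real (b j) * z)"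
    "poly (pderiv r) 0 = poly r 0 * of_real (\<Sum>j<k. b j)"
proof -
  have r0: "r \<noteq> 0" using assms by auto
  obtain xs where xs: "mset xs = proots r" using ex_mset by blast
  have len: "length xs \<le> k" using assms(1) by (metis size_mset size_proots_complex xs)
  have root: "poly r z = 0" if "z \<in> set xs" for z
    using that r0 by (metis mem_Collect_eq set_count_proots set_mset_mset xs)
  have inxs: "z \<in> \<real> \<and> Re z \<noteq> 0" if "z \<in> set xs" for z
  proof
    show "z \<in> \<real>" using root[OF that] assms(3) by blast
    then show "Re z \<noteq> 0"
      using root[OF that] assms(2) by (auto elim!: Reals_cases)
  qed
  define b where "b j = (if j < length xs then - inverse (Re (xs ! j)) else 0)" for j
  have b0: "b j \<ge> 0" if "\<And>z. poly r z = 0 \<Longrightarrow> Re z < 0" for j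
    using root[of "xs ! j"] that[of "xs ! j"] by (auto simp: b_def intro!: less_imp_le)
  have fac: "z - xs ! j = - xs ! j * (1 + of_real (b j) * z)" if "j < length xs" for j z
    using inxs[OF nth_mem[OF that]] that
    by (auto simp: b_def elim!: Reals_cases simp: field_simps)
  have ev: "poly r z = poly r 0 * (\<Prod>j<k. 1 + of_real (b j) * z)" for z
  proof -
    have 1: "poly r z = lead_coeff r * (\<Prod>j<length xs. z - xs ! j)" for z
    proof -
      have "poly r z = lead_coeff r * (\<Prod>a\<in>#proots r. z - a)"
        by (subst complex_poly_decompose_multiset[symmetric]) (simp add: poly_prod_mset)
      also have "(\<Prod>a\<in>#proots r. z - a) = (\<Prod>a\<leftarrow>xs. z - a)"
        by (simp add: xs[symmetric] flip: prod_mset_prod_list)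
      also have "\<dots> = (\<Prod>j<length xs. z - xs ! j)"
        by (simp add: prod.list_conv_set_nth atLeast0LessThan)
      finally show ?thesis .
    qed
    have "(\<Prod>j<length xs. z - xs ! j) = (\<Prod>j<length xs. 0 - xs ! j) * (\<Prod>j<length xs. 1 + of_real (b j) * z)"
      by (simp add: fac flip: prod.distrib)
    also have "(\<Prod>j<length xs. 1 + of_real (b j) * z) = (\<Prod>j<k. 1 + of_real (b j) * z)"
      using len by (intro prod.mono_neutral_left) (auto simp: b_def)
    finally show ?thesis by (simp add: 1)
  qed
  have "((\<lambda>z. poly r 0 * (\<Prod>j<k. 1 + of_real (b j) * z)) has_field_derivative
      poly r 0 * of_real (\<Sum>j<k. b j)) (at 0)"
    by (rule derivative_eq_intros has_field_derivative_prod refl | simp)+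
  then have "(poly r has_field_derivative poly r 0 * of_real (\<Sum>j<k. b j)) (at 0)"
    by (simp flip: ev)
  then have "poly (pderiv r) 0 = poly r 0 * of_real (\<Sum>j<k. b j)"
    using DERIV_unique poly_DERIV by blast
  with that[of b, OF b0 ev] show ?thesis by blast
qed

text \<open>
  The third identity is Newton's: it recovers the sum of squares of the \<open>b j\<close>, hence a bound for each of
  them, from two coefficients.
\<close>

lemma coeffs_prod_linear:
  fixes b :: "nat \<Rightarrow> real"
  defines "p k \<equiv> \<Prod>j<k. [:1, b j:]"
  shows "coeff (p k) 0 = 1" "coeff (p k) 1 = (\<Sum>j<k. b j)"
    "2 * coeff (p k) 2 = (\<Sum>j<k. b j)\<^sup>2 - (\<Sum>j<k. (b j)\<^sup>2)"
    "degree (p k) \<le> k" "coeff (p k) k = (\<Prod>j<k. b j)"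
proof -
  have p: "p (Suc k) = p k + smult (b k) (pCons 0 (p k))" for k
    by (simp add: p_def algebra_simps)
  show 0: "coeff (p k) 0 = 1" for k by (induction k) (simp add: p_def, simp add: p)
  show 1: "coeff (p k) 1 = (\<Sum>j<k. b j)" for k
  proof (induction k)
    case (Suc k)
    then show ?case using 0[of k] by (simp add: p)
  qed (simp add: p_def)
  show "2 * coeff (p k) 2 = (\<Sum>j<k. b j)\<^sup>2 - (\<Sum>j<k. (b j)\<^sup>2)" for k
  proof (induction k)
    case (Suc k)
    then show ?case using 1[of k]
      by (simp add: p coeff_pCons numeral_2_eq_2 power2_eq_square algebra_simps)
  qed (simp add: p_def)
  show deg: "degree (p k) \<le> k" for k
  proof (induction k)
    case (Suc k)
    then show ?case unfolding p
      by (intro degree_add_le) (auto intro: order.trans[OF degree_smult_le] order.trans[OF degree_pCons_le])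
  qed (simp add: p_def)
  show "coeff (p k) k = (\<Prod>j<k. b j)" for k
  proof (induction k)
    case (Suc k)
    then show ?case using deg[of k] by (simp add: p coeff_eq_0)
  qed (simp add: p_def)
qed

lemma real_poly_split_complex_root:
  fixes r :: "real poly"
  assumes "r \<noteq> 0" "size (proots r) = degree r" "poly (map_poly of_real r) (z::complex) = 0"
  shows "\<exists>a. poly r a = 0 \<and> z = of_real a"
  using assms
proof (induction "degree r" arbitrary: r)
  case 0
  then obtain a where "r = [:a:]" by (metis degree_eq_zeroE)
  with 0 show ?case by (simp add: map_poly_pCons)
next
  case (Suc n)
  then have "proots r \<noteq> {#}" by auto
  then obtain a where "a \<in># proots r" by blast
  then have a: "poly r a = 0" using Suc.prems(1) by simp
  then obtain s where s: "r = [:-a, 1:] * s" by (metis dvdE poly_eq_0_iff_dvd)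
  have s0: "s \<noteq> 0" using Suc.prems(1) s by auto
  have deg: "degree r = Suc (degree s)" unfolding s using s0 by (subst degree_mult_eq) auto
  have "proots r = {#a#} + proots s" unfolding s using s0 by (subst proots_mult) auto
  then have "size (proots s) = degree s" using Suc.prems(2) deg by simp
  moreover have "poly (map_poly of_real r) z = (z - of_real a) * poly (map_poly of_real s) z"
  proof -
    have "map_poly complex_of_real r = [:- of_real a, 1:] * map_poly of_real s"
      by (rule complex_poly_eqI_reals) (simp add: poly_map_of_real s algebra_simps)
    then show ?thesis by (simp only: poly_mult) simp
  qed
  ultimately show ?case
    using Suc.hyps(1)[of s] Suc.hyps(2) Suc.prems(3) s0 deg a by (auto simp: s)
qed

text \<open>
  The root with argument \<open>pi / k\<close> or \<open>2 * pi / k\<close>, according to the sign of \<open>D\<close>, lies strictly above the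
  real axis.
\<close>

lemma nonreal_root_of_real:
  fixes D :: real
  assumes "k > 1" "D < 0 \<or> k > 2" "D \<noteq> 0"
  obtains w :: complex where "w ^ k = of_real D" "w \<notin> \<real>"
proof -
  define \<theta> where "\<theta> = (if D < 0 then pi / k else 2 * pi / k)"
  define w where "w = of_real (root k \<bar>D\<bar>) * cis \<theta>"
  have "real k * \<theta> = (if D < 0 then pi else 2 * pi)" using assms(1) by (simp add: \<theta>_def)
  then have "w ^ k = of_real D"
    using assms(1)
    by (simp add: w_def power_mult_distrib Complex.DeMoivre flip: of_real_power)
  moreover have "\<theta> > 0" "\<theta> < pi"
    using assms by (auto simp: \<theta>_def field_simps)
  then have "Im w > 0" using assms by (simp add: w_def sin_gt_zero)
  then have "w \<notin> \<real>" by (auto simp: complex_is_Real_iff)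
  ultimately show ?thesis using that by blast
qed

lemma nonneg_poly_double_root:
  fixes g :: "real poly"
  assumes "\<And>t. poly g t \<ge> 0" "poly g 0 = 0"
  obtains h where "g = [:0, 0, 1:] * h"
proof -
  obtain g1 where g1: "g = pCons 0 g1" using assms(2) by (cases g) auto
  have "poly g1 0 = 0"
  proof (rule antisym)
    have lim: "(poly g1 \<longlongrightarrow> poly g1 0) (at 0)" by (simp add: isCont_def[symmetric])
    have *: "t * poly g1 t \<ge> 0" for t using assms(1)[of t] by (simp add: g1)
    show "poly g1 0 \<ge> 0"
    proof (rule tendsto_lowerbound)
      show "(poly g1 \<longlongrightarrow> poly g1 0) (at_right 0)" using lim by (simp add: filterlim_at_split)
      show "\<forall>\<^sub>F t in at_right 0. 0 \<le> poly g1 t"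
        using eventually_at_right_less[of 0]
      proof eventually_elim
        case (elim t)
        with *[of t] show ?case by (simp add: zero_le_mult_iff)
      qed
    qed simp
    show "poly g1 0 \<le> 0"
    proof (rule tendsto_upperbound)
      show "(poly g1 \<longlongrightarrow> poly g1 0) (at_left 0)" using lim by (simp add: filterlim_at_split)
      have "\<forall>\<^sub>F t in at_left 0. t < (0::real)" by (simp add: eventually_at_filter)
      then show "\<forall>\<^sub>F t in at_left 0. poly g1 t \<le> 0"
      proof eventually_elim
        case (elim t)
        with *[of t] show ?case by (simp add: zero_le_mult_iff)
      qed
    qed simp
  qed
  then obtain h where "g1 = pCons 0 h" by (cases g1) auto
  with g1 that show ?thesis by simp
qed

text \<open>
  This is the inequality of arithmetic and geometric means, normalized to mean \<open>1\<close>, with its equality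
  case. Both follow from \<open>u \<le> exp (u - 1)\<close>, which is strict for \<open>u \<noteq> 1\<close>.
\<close>

lemma prod_le_one_if_sum_eq_card:
  fixes u :: "'a \<Rightarrow> real"
  assumes "finite A" "\<And>j. j \<in> A \<Longrightarrow> u j \<ge> 0" "(\<Sum>j\<in>A. u j) = card A"
  shows "(\<Prod>j\<in>A. u j) \<le> 1" and "(\<Prod>j\<in>A. u j) = 1 \<Longrightarrow> j \<in> A \<Longrightarrow> u j = 1"
proof -
  have e: "(\<Prod>j\<in>A. exp (u j - 1)) = 1"
    using assms by (simp add: exp_sum[symmetric] sum_subtractf)
  have le: "u j \<le> exp (u j - 1)" for j using exp_ge_add_one_self[of "u j - 1"] by simp
  show "(\<Prod>j\<in>A. u j) \<le> 1"
    using prod_mono[of A u "\<lambda>j. exp (u j - 1)"] assms le e by simp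
  assume p: "(\<Prod>j\<in>A. u j) = 1" and j: "j \<in> A"
  show "u j = 1"
  proof (rule ccontr)
    assume "u j \<noteq> 1"
    then have lt: "u j < exp (u j - 1)" using exp_minus_greater[of "1 - u j"] by simp
    have pos: "\<And>i. i \<in> A \<Longrightarrow> u i > 0"
      using p assms(1,2) by (metis less_eq_real_def prod_zero zero_neq_one)
    have "(\<Prod>i\<in>A. u i) = u j * (\<Prod>i\<in>A - {j}. u i)" using assms(1) j by (simp add: prod.remove)
    also have "\<dots> < exp (u j - 1) * (\<Prod>i\<in>A - {j}. u i)"
      using lt pos by (intro mult_strict_right_mono prod_pos) auto
    also have "\<dots> \<le> exp (u j - 1) * (\<Prod>i\<in>A - {j}. exp (u i - 1))"
      using le pos by (intro mult_left_mono prod_mono) (auto intro: less_imp_le)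
    also have "\<dots> = 1" using assms(1) j e by (simp add: prod.remove)
    finally show False using p by simp
  qed
qed

section \<open>Homogeneous polynomials and their restrictions to lines\<close>

definition exps :: "'a set \<Rightarrow> nat \<Rightarrow> ('a \<Rightarrow> nat) set" where
  "exps S d = {\<alpha>. (\<forall>i. i \<notin> S \<longrightarrow> \<alpha> i = 0) \<and> sum \<alpha> S = d}"

text \<open>
  The coefficient ring is arbitrary: real and complex arguments are both needed, and polynomial arguments
  give the restriction to a line.
\<close>

definition hpoly :: "'a set \<Rightarrow> nat \<Rightarrow> (('a \<Rightarrow> nat) \<Rightarrow> 'b) \<Rightarrow> ('a \<Rightarrow> 'b) \<Rightarrow> 'b::comm_semiring_1" where
  "hpoly S d c z = (\<Sum>\<alpha>\<in>exps S d. c \<alpha> * (\<Prod>i\<in>S. z i ^ \<alpha> i))"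

lemma finite_exps: "finite S \<Longrightarrow> finite (exps S d)"
proof (rule finite_subset)
  assume S: "finite S"
  show "exps S d \<subseteq> {\<alpha>. \<forall>i. (i \<in> S \<longrightarrow> \<alpha> i \<in> {..d}) \<and> (i \<notin> S \<longrightarrow> \<alpha> i = 0)}"
    using S by (auto simp: exps_def intro: member_le_sum)
  show "finite {\<alpha>. \<forall>i. (i \<in> S \<longrightarrow> \<alpha> i \<in> {..d}) \<and> (i \<notin> S \<longrightarrow> \<alpha> i = (0::nat))}"
    by (rule finite_set_of_finite_funs) (use S in auto)
qed

lemma exps_0: "finite S \<Longrightarrow> exps S 0 = {\<lambda>_. 0}"
  by (auto simp: exps_def)

lemma exps_UNIV: "exps UNIV d = {\<alpha>. sum \<alpha> UNIV = d}"
  by (simp add: exps_def)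

lemma hpoly_degree_0: "finite S \<Longrightarrow> hpoly S 0 c z = c (\<lambda>_. 0)"
  by (simp add: hpoly_def exps_0)

lemma hpoly_cong:
  "(\<And>i. i \<in> S \<Longrightarrow> z i = w i) \<Longrightarrow> (\<And>\<alpha>. \<alpha> \<in> exps S d \<Longrightarrow> c \<alpha> = c' \<alpha>) \<Longrightarrow> hpoly S d c z = hpoly S d c' w"
  by (simp add: hpoly_def)

lemma hpoly_scale:
  "hpoly S d c (\<lambda>i. t * z i) = t ^ d * hpoly S d c z"
proof -
  have "(\<Prod>i\<in>S. (t * z i) ^ \<alpha> i) = t ^ d * (\<Prod>i\<in>S. z i ^ \<alpha> i)" if "\<alpha> \<in> exps S d" for \<alpha>
    using that by (auto simp: exps_def power_mult_distrib prod.distrib power_sum)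
  then show ?thesis
    by (simp add: hpoly_def sum_distrib_left mult.left_commute)
qed

lemma hpoly_of_real:
  "hpoly S d (\<lambda>\<alpha>. of_real (c \<alpha>)) (\<lambda>i. of_real (x i)) =
    (of_real (hpoly S d c x) :: 'b::{real_algebra_1,comm_ring_1})"
  by (simp add: hpoly_def)

lemma tendsto_hpoly:
  fixes c :: "('a \<Rightarrow> nat) \<Rightarrow> 'b::real_normed_field"
  assumes "\<And>i. i \<in> S \<Longrightarrow> ((\<lambda>x. f x i) \<longlongrightarrow> l i) F"
  shows "((\<lambda>x. hpoly S d c (f x)) \<longlongrightarrow> hpoly S d c l) F"
  unfolding hpoly_def by (intro tendsto_intros assms)

lemma continuous_on_hpoly:
  fixes c :: "('a \<Rightarrow> nat) \<Rightarrow> 'b::real_normed_field"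
  assumes "\<And>i. i \<in> S \<Longrightarrow> continuous_on X (\<lambda>x. f x i)"
  shows "continuous_on X (\<lambda>x. hpoly S d c (f x))"
  unfolding hpoly_def by (intro continuous_intros assms)

text \<open>
  The restriction to the line through \<open>z\<close> with direction \<open>w\<close>, as a polynomial in the parameter.
\<close>

definition hline :: "'a set \<Rightarrow> nat \<Rightarrow> (('a \<Rightarrow> nat) \<Rightarrow> 'b) \<Rightarrow> ('a \<Rightarrow> 'b) \<Rightarrow> ('a \<Rightarrow> 'b) \<Rightarrow> 'b::comm_semiring_1 poly" where
  "hline S d c z w = hpoly S d (\<lambda>\<alpha>. [:c \<alpha>:]) (\<lambda>i. [:z i, w i:])"

lemma poly_hline [simp]: "poly (hline S d c z w) t = hpoly S d c (\<lambda>i. z i + t * w i)"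
  by (simp add: hline_def hpoly_def poly_sum poly_prod)

lemma coeff_mult_at_bounds:
  fixes p q :: "'b::comm_semiring_1 poly"
  assumes "degree p \<le> m" "degree q \<le> n"
  shows "coeff (p * q) (m + n) = coeff p m * coeff q n"
proof (cases "degree p = m \<and> degree q = n")
  case True
  then show ?thesis using coeff_mult_degree_sum by blast
next
  case False
  then have lt: "degree p < m \<or> degree q < n" using assms by linarith
  then have "degree (p * q) < m + n" using degree_mult_le[of p q] assms by linarith
  with lt show ?thesis by (auto simp: coeff_eq_0)
qed

lemma power_linear_poly:
  fixes a b :: "'b::comm_semiring_1"
  shows "degree ([:a, b:] ^ n) \<le> n \<and> coeff ([:a, b:] ^ n) n = b ^ n"
proof (induction n)
  case (Suc n)
  have "degree [:a, b:] \<le> 1" by simp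
  with Suc coeff_mult_at_bounds[of "[:a, b:]" 1 "[:a, b:] ^ n" n]
    degree_mult_le[of "[:a, b:]" "[:a, b:] ^ n"]
  show ?case by (auto simp del: mult_pCons_left)
qed simp

lemma prod_power_linear_poly:
  fixes z w :: "'a \<Rightarrow> 'b::comm_semiring_1"
  assumes "finite S"
  shows "degree (\<Prod>i\<in>S. [:z i, w i:] ^ \<alpha> i) \<le> sum \<alpha> S
    \<and> coeff (\<Prod>i\<in>S. [:z i, w i:] ^ \<alpha> i) (sum \<alpha> S) = (\<Prod>i\<in>S. w i ^ \<alpha> i)"
  using assms
proof (induction S)
  case (insert i S)
  let ?q = "\<Prod>i\<in>S. [:z i, w i:] ^ \<alpha> i"
  from power_linear_poly[of "z i" "w i" "\<alpha> i"] insert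
    coeff_mult_at_bounds[of "[:z i, w i:] ^ \<alpha> i" "\<alpha> i" ?q "sum \<alpha> S"]
    degree_mult_le[of "[:z i, w i:] ^ \<alpha> i" ?q]
  show ?case by auto
qed simp

lemma degree_hline: "finite S \<Longrightarrow> degree (hline S d c z w) \<le> d"
  unfolding hline_def hpoly_def
proof (intro degree_sum_le finite_exps)
  fix \<alpha> assume "finite S" "\<alpha> \<in> exps S d"
  then show "degree ([:c \<alpha>:] * (\<Prod>i\<in>S. [:z i, w i:] ^ \<alpha> i)) \<le> d"
    using prod_power_linear_poly[of S z w \<alpha>]
    by (auto simp: exps_def intro: order.trans[OF degree_smult_le])
qed

lemma coeff_hline: "finite S \<Longrightarrow> coeff (hline S d c z w) d = hpoly S d c w"
  unfolding hline_def hpoly_def coeff_sum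
  using prod_power_linear_poly[of S z w]
  by (intro sum.cong) (auto simp: exps_def)

lemma degree_hline_eq:
  assumes "finite S" "hpoly S d c w \<noteq> 0"
  shows "degree (hline S d c z w) = d" "lead_coeff (hline S d c z w) = hpoly S d c w"
    "hline S d c z w \<noteq> 0"
proof -
  have "coeff (hline S d c z w) d \<noteq> 0" using assms by (simp add: coeff_hline)
  then show "degree (hline S d c z w) = d"
    using degree_hline[OF assms(1), of d c z w] le_degree by (metis le_antisym)
  then show "lead_coeff (hline S d c z w) = hpoly S d c w" "hline S d c z w \<noteq> 0"
    using assms coeff_hline[OF assms(1), of d c z w] by auto
qed

lemma hline_of_real:
  "hline S d (\<lambda>\<alpha>. complex_of_real (c \<alpha>)) (\<lambda>i. of_real (z i)) (\<lambda>i. of_real (w i)) =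
    map_poly of_real (hline S d c z w)"
  by (rule complex_poly_eqI_reals)
    (simp add: poly_map_of_real flip: hpoly_of_real of_real_mult of_real_add)

text \<open>
  If the direction moves along a line itself, each coefficient of the restriction depends polynomially on
  the position: compute the restriction once over the ring of polynomials in \<open>\<epsilon>\<close>.
\<close>

lemma coeff_hline_affine:
  fixes c :: "('a \<Rightarrow> nat) \<Rightarrow> real"
  obtains g :: "real poly" where "\<And>\<epsilon>. coeff (hline S d c e (\<lambda>i. v i + \<epsilon> * x i)) j = poly g \<epsilon>"
proof -
  define W where "W = hline S d (\<lambda>\<alpha>. [:c \<alpha>:]) (\<lambda>i. [:e i:]) (\<lambda>i. [:v i, x i:])"
  have ev: "poly (map_poly (\<lambda>p. poly p \<epsilon>) F) t = poly (poly F [:t:]) \<epsilon>" for F :: "real poly poly" and \<epsilon> t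
    by (induction F) (auto simp: map_poly_pCons)
  have mp: "map_poly (\<lambda>p. poly p \<epsilon>) W = hline S d c e (\<lambda>i. v i + \<epsilon> * x i)" for \<epsilon>
  proof (rule poly_eqI_infinite[OF infinite_UNIV_char_0])
    fix t
    have "poly (map_poly (\<lambda>p. poly p \<epsilon>) W) t =
        poly (hpoly S d (\<lambda>\<alpha>. [:c \<alpha>:]) (\<lambda>i. [:e i:] + [:t:] * [:v i, x i:])) \<epsilon>"
      by (simp add: ev W_def)
    also have "\<dots> = hpoly S d c (\<lambda>i. e i + t * (v i + \<epsilon> * x i))"
      by (simp add: hpoly_def poly_sum poly_prod algebra_simps)
    finally show "poly (map_poly (\<lambda>p. poly p \<epsilon>) W) t = poly (hline S d c e (\<lambda>i. v i + \<epsilon> * x i)) t"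
      by simp
  qed
  have "coeff (hline S d c e (\<lambda>i. v i + \<epsilon> * x i)) j = poly (coeff W j) \<epsilon>" for \<epsilon>
    by (simp add: coeff_map_poly flip: mp)
  then show ?thesis using that by blast
qed

text \<open>
  The effect of the partial derivative by the variable \<open>i\<close> on the coefficients.
\<close>

definition pd_coeffs :: "'a \<Rightarrow> (('a \<Rightarrow> nat) \<Rightarrow> 'b) \<Rightarrow> ('a \<Rightarrow> nat) \<Rightarrow> 'b::comm_semiring_1" where
  "pd_coeffs i c \<alpha> = of_nat (\<alpha> i + 1) * c (\<alpha>(i := \<alpha> i + 1))"

lemma sum_exps_Suc:
  assumes S: "finite S" "i \<in> S"
  shows "(\<Sum>\<alpha>\<in>exps S (Suc d). c \<alpha> * (of_nat (\<alpha> i) * z i ^ (\<alpha> i - 1) * (\<Prod>j\<in>S - {i}. z j ^ \<alpha> j)))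
    = hpoly S d (pd_coeffs i c) z" (is "sum ?f _ = _")
proof -
  have up: "\<alpha>(i := \<alpha> i + 1) \<in> exps S (Suc d)" if "\<alpha> \<in> exps S d" for \<alpha>
    using that S by (auto simp: exps_def sum.remove[of S i])
  have dn: "\<alpha>(i := \<alpha> i - 1) \<in> exps S d" if "\<alpha> \<in> exps S (Suc d)" "\<alpha> i \<noteq> 0" for \<alpha>
    using that S by (auto simp: exps_def sum.remove[of S i])
  have "sum ?f (exps S (Suc d)) = sum ?f {\<alpha> \<in> exps S (Suc d). \<alpha> i \<noteq> 0}"
    by (rule sum.mono_neutral_right) (auto simp: finite_exps S)
  also have "\<dots> = hpoly S d (pd_coeffs i c) z"
    unfolding hpoly_def
  proof (rule sum.reindex_bij_witness[of _ "\<lambda>\<alpha>. \<alpha>(i := \<alpha> i + 1)" "\<lambda>\<alpha>. \<alpha>(i := \<alpha> i - 1)"])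
    fix \<alpha> assume a: "\<alpha> \<in> {\<alpha> \<in> exps S (Suc d). \<alpha> i \<noteq> 0}"
    have "(\<Prod>j\<in>S - {i}. z j ^ (\<alpha>(i := \<alpha> i - 1)) j) = (\<Prod>j\<in>S - {i}. z j ^ \<alpha> j)"
      by (rule prod.cong) auto
    with a show "pd_coeffs i c (\<alpha>(i := \<alpha> i - 1)) * (\<Prod>j\<in>S. z j ^ (\<alpha>(i := \<alpha> i - 1)) j) = ?f \<alpha>"
      using S by (simp add: pd_coeffs_def prod.remove[of S i] mult_ac)
  qed (use up dn in auto)
  finally show ?thesis .
qed

lemma hpoly_has_field_derivative:
  fixes z w :: "'a \<Rightarrow> 'b::real_normed_field"
  assumes S: "finite S"
  shows "((\<lambda>t. hpoly S (Suc d) c (\<lambda>i. z i + t * w i)) has_field_derivative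
    (\<Sum>i\<in>S. w i * hpoly S d (pd_coeffs i c) z)) (at 0)"
proof -
  have "((\<lambda>t. hpoly S (Suc d) c (\<lambda>i. z i + t * w i)) has_field_derivative
    (\<Sum>\<alpha>\<in>exps S (Suc d). c \<alpha> * (\<Sum>i\<in>S. w i * (of_nat (\<alpha> i) * z i ^ (\<alpha> i - 1)) * (\<Prod>j\<in>S - {i}. z j ^ \<alpha> j)))) (at 0)"
    unfolding hpoly_def
    by (rule derivative_eq_intros has_field_derivative_prod refl | simp add: mult_ac)+
  also have "(\<Sum>\<alpha>\<in>exps S (Suc d). c \<alpha> * (\<Sum>i\<in>S. w i * (of_nat (\<alpha> i) * z i ^ (\<alpha> i - 1)) * (\<Prod>j\<in>S - {i}. z j ^ \<alpha> j)))
    = (\<Sum>i\<in>S. w i * (\<Sum>\<alpha>\<in>exps S (Suc d). c \<alpha> * (of_nat (\<alpha> i) * z i ^ (\<alpha> i - 1) * (\<Prod>j\<in>S - {i}. z j ^ \<alpha> j))))"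
    unfolding sum_distrib_left by (subst sum.swap) (simp add: mult_ac)
  also have "\<dots> = (\<Sum>i\<in>S. w i * hpoly S d (pd_coeffs i c) z)"
    by (simp only: sum_exps_Suc[OF S] cong: sum.cong)
  finally show ?thesis .
qed

definition dir_deriv :: "'a set \<Rightarrow> ('a \<Rightarrow> 'b) \<Rightarrow> (('a \<Rightarrow> nat) \<Rightarrow> 'b) \<Rightarrow> ('a \<Rightarrow> nat) \<Rightarrow> 'b::comm_semiring_1" where
  "dir_deriv S w c \<alpha> = (\<Sum>i\<in>S. w i * pd_coeffs i c \<alpha>)"

lemma hpoly_dir_deriv: "hpoly S d (dir_deriv S w c) z = (\<Sum>i\<in>S. w i * hpoly S d (pd_coeffs i c) z)"
  unfolding hpoly_def dir_deriv_def sum_distrib_left sum_distrib_right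
  by (subst sum.swap) (simp add: mult_ac)

lemma pd_coeffs_of_real: "pd_coeffs i (\<lambda>\<alpha>. of_real (c \<alpha>)) = (\<lambda>\<alpha>. of_real (pd_coeffs i c \<alpha>))"
  by (simp add: pd_coeffs_def fun_eq_iff)

lemma dir_deriv_of_real:
  "dir_deriv S (\<lambda>i. of_real (w i)) (\<lambda>\<alpha>. of_real (c \<alpha>)) = (\<lambda>\<alpha>. of_real (dir_deriv S w c \<alpha>))"
  by (simp add: dir_deriv_def pd_coeffs_of_real fun_eq_iff)

lemma pderiv_hline_0:
  fixes c :: "('a \<Rightarrow> nat) \<Rightarrow> 'b::real_normed_field"
  assumes "finite S"
  shows "poly (pderiv (hline S (Suc d) c z w)) 0 = hpoly S d (dir_deriv S w c) z"
proof -
  have "poly (hline S (Suc d) c z w) = (\<lambda>t. hpoly S (Suc d) c (\<lambda>i. z i + t * w i))"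
    by (simp add: fun_eq_iff)
  then have "(poly (hline S (Suc d) c z w) has_field_derivative hpoly S d (dir_deriv S w c) z) (at 0)"
    using hpoly_has_field_derivative[OF assms, of d c z w] by (simp add: hpoly_dir_deriv)
  then show ?thesis using DERIV_unique poly_DERIV by blast
qed

text \<open>
  The coefficient of the first power of the variable \<open>i\<close>, as a polynomial in the other variables.
\<close>

definition slice :: "'a \<Rightarrow> (('a \<Rightarrow> nat) \<Rightarrow> 'b) \<Rightarrow> ('a \<Rightarrow> nat) \<Rightarrow> 'b" where
  "slice i c \<alpha> = c (\<alpha>(i := 1))"

lemma hpoly_slice:
  assumes S: "finite S" "i \<in> S"
  shows "hpoly (S - {i}) d (slice i c) z = hpoly S d (pd_coeffs i c) (z(i := 0))"
proof -
  have "hpoly S d (pd_coeffs i c) (z(i := 0)) =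
      (\<Sum>\<alpha>\<in>{\<alpha> \<in> exps S d. \<alpha> i = 0}. pd_coeffs i c \<alpha> * (\<Prod>j\<in>S. (z(i := 0)) j ^ \<alpha> j))"
    unfolding hpoly_def
    by (rule sum.mono_neutral_right) (use S in \<open>auto simp: finite_exps prod.remove[of S i] power_0_left split: if_splits\<close>)
  also have "{\<alpha> \<in> exps S d. \<alpha> i = 0} = exps (S - {i}) d"
    using S by (auto simp: exps_def sum.remove[of S i])
  also have "(\<Sum>\<alpha>\<in>exps (S - {i}) d. pd_coeffs i c \<alpha> * (\<Prod>j\<in>S. (z(i := 0)) j ^ \<alpha> j))
      = hpoly (S - {i}) d (slice i c) z"
    unfolding hpoly_def
  proof (rule sum.cong[OF refl])
    fix \<alpha> assume "\<alpha> \<in> exps (S - {i}) d"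
    then have "\<alpha> i = 0" by (auto simp: exps_def)
    moreover have "(\<Prod>j\<in>S - {i}. (z(i := 0)) j ^ \<alpha> j) = (\<Prod>j\<in>S - {i}. z j ^ \<alpha> j)"
      by (rule prod.cong) auto
    ultimately show "pd_coeffs i c \<alpha> * (\<Prod>j\<in>S. (z(i := 0)) j ^ \<alpha> j)
        = slice i c \<alpha> * (\<Prod>j\<in>S - {i}. z j ^ \<alpha> j)"
      using S by (simp add: pd_coeffs_def slice_def prod.remove[of S i])
  qed
  finally show ?thesis ..
qed

lemma slice_has_field_derivative:
  fixes c :: "('a \<Rightarrow> nat) \<Rightarrow> 'b::real_normed_field"
  assumes S: "finite S" "i \<in> S"
  shows "((\<lambda>t. hpoly S (Suc d) c (y(i := t))) has_field_derivative hpoly (S - {i}) d (slice i c) y) (at 0)"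
proof -
  define w where "w = (\<lambda>j. if j = i then 1 else 0 :: 'b)"
  have "(\<Sum>j\<in>S. w j * hpoly S d (pd_coeffs j c) (y(i := 0))) = hpoly (S - {i}) d (slice i c) y"
    using S by (simp add: w_def hpoly_slice if_distrib if_distribR cong: if_cong)
  moreover have "(\<lambda>j. (y(i := 0)) j + t * w j) = y(i := t)" for t
    by (auto simp: w_def)
  ultimately show ?thesis
    using hpoly_has_field_derivative[OF S(1), of d c "y(i := 0)" w] by simp
qed

text \<open>
  The exponent vector of the product of the variables in \<open>S\<close>.
\<close>

definition ones :: "'a set \<Rightarrow> 'a \<Rightarrow> nat" where
  "ones S = (\<lambda>i. if i \<in> S then 1 else 0)"

lemma slice_ones: "i \<in> S \<Longrightarrow> slice i c (ones (S - {i})) = c (ones S)"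
  unfolding slice_def by (rule arg_cong[of _ _ c]) (auto simp: ones_def)

lemma foldr_pd_coeffs:
  assumes "distinct vs" "\<And>i. i \<in> set vs \<Longrightarrow> \<beta> i = 0"
  shows "foldr pd_coeffs vs c \<beta> = c (\<lambda>i. if i \<in> set vs then 1 else \<beta> i)"
  using assms
proof (induction vs arbitrary: \<beta>)
  case (Cons i vs)
  have "foldr pd_coeffs (i # vs) c \<beta> = foldr pd_coeffs vs c (\<beta>(i := 1))"
    using Cons.prems by (simp add: pd_coeffs_def)
  also have "\<dots> = c (\<lambda>j. if j \<in> set vs then 1 else (\<beta>(i := 1)) j)"
    using Cons.prems by (intro Cons.IH) auto
  also have "(\<lambda>j. if j \<in> set vs then 1 else (\<beta>(i := 1)) j) = (\<lambda>j. if j \<in> set (i # vs) then 1 else \<beta> j)"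
    by auto
  finally show ?case .
qed simp

section \<open>Polynomials without zeros in the right half-plane\<close>

abbreviation chpoly :: "'a set \<Rightarrow> nat \<Rightarrow> (('a \<Rightarrow> nat) \<Rightarrow> real) \<Rightarrow> ('a \<Rightarrow> complex) \<Rightarrow> complex" where
  "chpoly S d c \<equiv> hpoly S d (\<lambda>\<alpha>. complex_of_real (c \<alpha>))"

text \<open>
  The second clause fixes the sign; the first one alone would also admit the negative of the polynomial.
\<close>

definition hstable :: "'a set \<Rightarrow> nat \<Rightarrow> (('a \<Rightarrow> nat) \<Rightarrow> real) \<Rightarrow> bool" where
  "hstable S d c \<longleftrightarrow>
     (\<forall>z. (\<forall>i\<in>S. Re (z i) > 0) \<longrightarrow> chpoly S d c z \<noteq> 0) \<and>
     (\<forall>x. (\<forall>i\<in>S. x i > 0) \<longrightarrow> hpoly S d c x > 0)"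

lemma hstable_nonzero: "hstable S d c \<Longrightarrow> (\<And>i. i \<in> S \<Longrightarrow> Re (z i) > 0) \<Longrightarrow> chpoly S d c z \<noteq> 0"
  and hstable_pos: "hstable S d c \<Longrightarrow> (\<And>i. i \<in> S \<Longrightarrow> x i > 0) \<Longrightarrow> hpoly S d c x > 0"
  by (auto simp: hstable_def)

lemma hstable_nonneg:
  assumes c: "hstable S d c" and x: "\<And>i. i \<in> S \<Longrightarrow> x i \<ge> (0::real)"
  shows "hpoly S d c x \<ge> 0"
proof -
  have "((\<lambda>\<epsilon>. hpoly S d c (\<lambda>i. x i + \<epsilon>)) \<longlongrightarrow> hpoly S d c (\<lambda>i. x i + 0)) (at_right 0)"
    by (intro tendsto_hpoly tendsto_intros)
  moreover have "\<forall>\<^sub>F \<epsilon> in at_right 0. 0 \<le> hpoly S d c (\<lambda>i. x i + \<epsilon>)"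
    using eventually_at_right_less[of 0]
  proof eventually_elim
    case (elim \<epsilon>)
    show ?case by (rule less_imp_le, rule hstable_pos[OF c]) (use x elim in \<open>auto intro: add_nonneg_pos\<close>)
  qed
  ultimately show ?thesis
    using tendsto_lowerbound by fastforce
qed

text \<open>
  Stability together with homogeneity gives hyperbolicity in every positive direction: the half-plane can be
  rotated, so a nonreal root would be moved to a forbidden zero.
\<close>

lemma hstable_real_rooted:
  assumes c: "hstable S d c" and x: "\<And>i. i \<in> S \<Longrightarrow> x i > (0::real)"
    and t: "chpoly S d c (\<lambda>i. of_real (y i) + t * of_real (x i)) = 0"
  shows "t \<in> \<real>"
proof (rule ccontr)
  assume "t \<notin> \<real>"
  then have im: "Im t \<noteq> 0" by (simp add: complex_is_Real_iff)
  \<comment> \<open>This factor turns \<open>y i + t * x i\<close> into a number with real part \<open>(Im t)\<^sup>2 * x i > 0\<close>.\<close>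
  let ?u = "- \<i> * of_real (Im t)"
  have re: "Re (?u * (of_real (y i) + t * of_real (x i))) = (Im t)\<^sup>2 * x i" for i
    by (simp add: power2_eq_square)
  have "chpoly S d c (\<lambda>i. ?u * (of_real (y i) + t * of_real (x i))) \<noteq> 0"
    using x im by (intro hstable_nonzero[OF c]) (simp only: re, simp)
  with t show False by (simp only: hpoly_scale mult_zero_right)
qed

text \<open>
  Unless \<open>t\<close> is a real number \<open>\<le> 0\<close>, dividing by a square root of \<open>t\<close> with positive real part takes \<open>1\<close> and
  \<open>t\<close> to two points with positive real part.
\<close>

lemma hstable_coordinate_line_roots:
  assumes i: "i \<in> S" and c: "hstable S d c" and y: "\<And>j. j \<in> S - {i} \<Longrightarrow> y j > (0::real)"
    and t: "chpoly S d c ((\<lambda>j. of_real (y j))(i := t)) = 0"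
  shows "t \<in> \<real> \<and> Re t \<le> 0"
proof (rule ccontr)
  assume neg: "\<not> (t \<in> \<real> \<and> Re t \<le> 0)"
  define s where "s = csqrt t"
  have s2: "s * s = t" unfolding s_def by (simp flip: power2_eq_square)
  have "Re s \<noteq> 0"
  proof
    assume "Re s = 0"
    then have "t = of_real (- (Im s)\<^sup>2)"
      unfolding s2[symmetric] by (simp add: complex_eq_iff power2_eq_square)
    with neg show False by simp
  qed
  moreover have "Re s \<ge> 0" by (metis csqrt_principal less_eq_real_def order_refl s_def)
  ultimately have s: "Re s > 0" by simp
  then have s0: "s \<noteq> 0" by auto
  have inv: "Re (inverse s) > 0" using s by (simp add: add_pos_nonneg)
  have "inverse s * ((\<lambda>j. of_real (y j))(i := t)) j = (if j = i then s else inverse s * of_real (y j))" for j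
    using s0 by (simp flip: s2)
  moreover have "Re (if j = i then s else inverse s * of_real (y j)) > 0" if "j \<in> S" for j
    using that s y inv by (cases "j = i") (auto intro!: divide_pos_pos mult_pos_pos add_pos_nonneg)
  ultimately have "chpoly S d c (\<lambda>j. inverse s * ((\<lambda>j. of_real (y j))(i := t)) j) \<noteq> 0"
    by (intro hstable_nonzero[OF c]) (simp only:)
  with t show False by (simp only: hpoly_scale mult_zero_right)
qed

text \<open>
  Restrict to the line \<open>Re z + t * Im z\<close>, on which all roots \<open>t\<close> are real, and compare the values at
  \<open>t = \<i>\<close> and \<open>t = 0\<close>. Unlike the nonvanishing of a stable polynomial, this inequality is
  preserved by limits.
\<close>

lemma hstable_norm_ge:
  assumes c: "hstable S d c" and z: "\<And>i. i \<in> S \<Longrightarrow> Re (z i) > 0"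
  shows "norm (chpoly S d c z) \<ge> hpoly S d c (\<lambda>i. Re (z i))"
proof -
  let ?x = "\<lambda>i. complex_of_real (Re (z i))" and ?y = "\<lambda>i. complex_of_real (Im (z i))"
  define r where "r = hline S d (\<lambda>\<alpha>. complex_of_real (c \<alpha>)) ?x ?y"
  have pos: "hpoly S d c (\<lambda>i. Re (z i)) > 0" using hstable_pos[OF c] z by simp
  have r0: "poly r 0 = of_real (hpoly S d c (\<lambda>i. Re (z i)))"
    by (simp add: r_def hpoly_of_real)
  then have "r \<noteq> 0" using pos by auto
  moreover have "t \<in> \<real>" if "poly r t = 0" for t
  proof (cases "t = 0")
    case False
    have "chpoly S d c (\<lambda>i. ?x i + t * ?y i) = 0" using that by (simp add: r_def)
    also have "(\<lambda>i. ?x i + t * ?y i) = (\<lambda>i. t * (?y i + inverse t * ?x i))"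
      using False by (simp add: fun_eq_iff distrib_left flip: mult.assoc)
    finally have "chpoly S d c (\<lambda>i. ?y i + inverse t * ?x i) = 0"
      unfolding hpoly_scale using False by simp
    then have "inverse t \<in> \<real>"
      using hstable_real_rooted[OF c, of "\<lambda>i. Re (z i)" "\<lambda>i. Im (z i)" "inverse t"] z by simp
    then show ?thesis using Reals_inverse[of "inverse t"] by simp
  qed simp
  ultimately have "norm (poly r 0) \<le> norm (poly r \<i>)" by (rule norm_at_ii_ge)
  moreover have "poly r \<i> = chpoly S d c z"
    by (simp add: r_def complex_eq[symmetric])
  ultimately show ?thesis using pos by (simp add: r0)
qed

text \<open>
  Seen from a point with positive real parts, all roots along a positive direction lie in the left
  half-plane, so the logarithmic derivative has positive real part.
\<close>

lemma hstable_dir_deriv: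
  assumes S: "finite S" and c: "hstable S (Suc d) c" and w: "\<And>i. i \<in> S \<Longrightarrow> w i > (0::real)"
  shows "hstable S d (dir_deriv S w c)"
proof -
  let ?w = "\<lambda>i. complex_of_real (w i)"
  have main: "Re (chpoly S d (dir_deriv S w c) z / chpoly S (Suc d) c z) > 0"
    if z: "\<And>i. i \<in> S \<Longrightarrow> Re (z i) > 0" for z
  proof -
    let ?r = "hline S (Suc d) (\<lambda>\<alpha>. complex_of_real (c \<alpha>)) z ?w"
    have "chpoly S (Suc d) c ?w \<noteq> 0" using w by (intro hstable_nonzero[OF c]) simp
    then have "degree ?r > 0" using degree_hline_eq(1)[OF S, of "Suc d" _ ?w z] by simp
    moreover have "Re t < 0" if "poly ?r t = 0" for t
    proof (rule ccontr)
      assume "\<not> Re t < 0"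
      then have "chpoly S (Suc d) c (\<lambda>i. z i + t * ?w i) \<noteq> 0"
        using w z by (intro hstable_nonzero[OF c]) (simp add: add_pos_nonneg less_imp_le not_less)
      with that show False by simp
    qed
    ultimately have "Re (poly (pderiv ?r) 0 / poly ?r 0) > 0" by (rule Re_logderiv_pos)
    then show ?thesis by (simp add: pderiv_hline_0 S dir_deriv_of_real)
  qed
  show ?thesis unfolding hstable_def
  proof (intro conjI allI impI)
    fix z :: "'a \<Rightarrow> complex" assume "\<forall>i\<in>S. Re (z i) > 0"
    with main[of z] show "chpoly S d (dir_deriv S w c) z \<noteq> 0" by auto
  next
    fix x :: "'a \<Rightarrow> real" assume x: "\<forall>i\<in>S. x i > 0"
    then have "hpoly S d (dir_deriv S w c) x / hpoly S (Suc d) c x > 0"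
      using main[of "\<lambda>i. of_real (x i)"] by (simp add: hpoly_of_real flip: of_real_divide)
    moreover have "hpoly S (Suc d) c x > 0" using x hstable_pos[OF c] by simp
    ultimately show "hpoly S d (dir_deriv S w c) x > 0" by (simp add: zero_less_divide_iff)
  qed
qed

text \<open>
  The slice is a derivative in an axis direction, evaluated where the variable is zero. Both the direction
  and the point lie on the boundary of the region where stability speaks, so they are moved into the
  interior by \<open>\<epsilon>\<close>, and the inequality of \<open>hstable_norm_ge\<close> is taken to the limit. Positivity of
  the slice on the positive orthant turns the limit inequality into nonvanishing.
\<close>

lemma hstable_slice:
  assumes S: "finite S" "i \<in> S" and c: "hstable S (Suc d) c"
    and pos: "\<And>y. (\<And>j. j \<in> S - {i} \<Longrightarrow> y j > 0) \<Longrightarrow> hpoly (S - {i}) d (slice i c) y > 0"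
  shows "hstable (S - {i}) d (slice i c)"
  unfolding hstable_def
proof (intro conjI allI impI)
  fix z :: "'a \<Rightarrow> complex" assume z: "\<forall>j\<in>S - {i}. Re (z j) > 0"
  define w where "w = (\<lambda>\<epsilon> j. (if j = i then 1 else 0) + \<epsilon> :: real)"
  define y where "y = (\<lambda>\<epsilon> j. (z(i := 0)) j + complex_of_real \<epsilon>)"
  have lim1: "((\<lambda>\<epsilon>. chpoly S d (dir_deriv S (w \<epsilon>) c) (y \<epsilon>)) \<longlongrightarrow>
      chpoly S d (pd_coeffs i c) (z(i := 0))) (at_right 0)"
  proof -
    have "((\<lambda>\<epsilon>. \<Sum>j\<in>S. of_real (w \<epsilon> j) * hpoly S d (pd_coeffs j (\<lambda>\<alpha>. complex_of_real (c \<alpha>))) (y \<epsilon>)) \<longlongrightarrow>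
        (\<Sum>j\<in>S. of_real (w 0 j) * hpoly S d (pd_coeffs j (\<lambda>\<alpha>. complex_of_real (c \<alpha>))) (y 0))) (at_right 0)"
      unfolding w_def y_def by (intro tendsto_intros tendsto_hpoly)
    also have "(\<Sum>j\<in>S. of_real (w 0 j) * hpoly S d (pd_coeffs j (\<lambda>\<alpha>. complex_of_real (c \<alpha>))) (y 0))
        = chpoly S d (pd_coeffs i c) (z(i := 0))"
      using S by (simp add: w_def y_def pd_coeffs_of_real if_distrib if_distribR fun_upd_def cong: if_cong)
    finally show ?thesis
      by (simp add: hpoly_dir_deriv flip: dir_deriv_of_real)
  qed
  have lim2: "((\<lambda>\<epsilon>. hpoly S d (dir_deriv S (w \<epsilon>) c) (\<lambda>j. Re (y \<epsilon> j))) \<longlongrightarrow>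
      hpoly S d (pd_coeffs i c) (\<lambda>j. Re ((z(i := 0)) j))) (at_right 0)"
  proof -
    have "((\<lambda>\<epsilon>. \<Sum>j\<in>S. w \<epsilon> j * hpoly S d (pd_coeffs j c) (\<lambda>j. Re (y \<epsilon> j))) \<longlongrightarrow>
        (\<Sum>j\<in>S. w 0 j * hpoly S d (pd_coeffs j c) (\<lambda>j. Re (y 0 j)))) (at_right 0)"
      unfolding w_def y_def by (intro tendsto_intros tendsto_hpoly)
    also have "(\<Sum>j\<in>S. w 0 j * hpoly S d (pd_coeffs j c) (\<lambda>j. Re (y 0 j)))
        = hpoly S d (pd_coeffs i c) (\<lambda>j. Re ((z(i := 0)) j))"
      using S by (simp add: w_def y_def if_distrib if_distribR fun_upd_def cong: if_cong)
    finally show ?thesis by (simp add: hpoly_dir_deriv)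
  qed
  have "\<forall>\<^sub>F \<epsilon> in at_right 0. hpoly S d (dir_deriv S (w \<epsilon>) c) (\<lambda>j. Re (y \<epsilon> j))
      \<le> norm (chpoly S d (dir_deriv S (w \<epsilon>) c) (y \<epsilon>))"
    using eventually_at_right_less[of 0]
  proof eventually_elim
    case (elim \<epsilon>)
    then show ?case
      using z by (intro hstable_norm_ge hstable_dir_deriv S c) (auto simp: w_def y_def add_pos_pos)
  qed
  then have "hpoly S d (pd_coeffs i c) (\<lambda>j. Re ((z(i := 0)) j)) \<le> norm (chpoly S d (pd_coeffs i c) (z(i := 0)))"
    by (intro tendsto_le[OF _ tendsto_norm[OF lim1] lim2]) auto
  also have "(\<lambda>j. Re ((z(i := 0)) j)) = (\<lambda>j. Re (z j))(i := 0)" by auto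
  finally have "hpoly (S - {i}) d (slice i c) (\<lambda>j. Re (z j)) \<le>
      norm (hpoly (S - {i}) d (slice i (\<lambda>\<alpha>. complex_of_real (c \<alpha>))) z)"
    by (simp add: hpoly_slice S pd_coeffs_of_real fun_upd_def)
  moreover have "hpoly (S - {i}) d (slice i c) (\<lambda>j. Re (z j)) > 0" using z by (intro pos) auto
  ultimately show "chpoly (S - {i}) d (slice i c) z \<noteq> 0"
    by (auto simp: slice_def[abs_def])
qed (use pos in auto)

lemma hstable_coordinate_line_product:
  assumes S: "finite S" "i \<in> S" and c: "hstable S (Suc d) c"
    and y: "\<And>j. j \<in> S - {i} \<Longrightarrow> y j > 0"
    and R_def: "R = hpoly S (Suc d) c (y(i := 0))" and R: "R \<noteq> 0"
  obtains b :: "nat \<Rightarrow> real" where "\<And>j. b j \<ge> 0"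
    "\<And>t. hpoly S (Suc d) c (y(i := t)) = R * (\<Prod>j<Suc d. 1 + b j * t)"
    "hpoly (S - {i}) d (slice i c) y = R * (\<Sum>j<Suc d. b j)"
proof -
  let ?w = "\<lambda>j. if j = i then 1 else 0 :: complex"
  define z where "z = (\<lambda>j. complex_of_real (y j))"
  define r where "r = hline S (Suc d) (\<lambda>\<alpha>. complex_of_real (c \<alpha>)) (z(i := 0)) ?w"
  have "(\<lambda>j. (z(i := 0)) j + t * ?w j) = z(i := t)" for t by auto
  then have r: "poly r t = chpoly S (Suc d) c (z(i := t))" for t by (simp add: r_def)
  have "z(i := of_real t) = (\<lambda>j. of_real ((y(i := t)) j))" for t by (auto simp: z_def)
  then have re: "poly r (of_real t) = of_real (hpoly S (Suc d) c (y(i := t)))" for t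
    unfolding r by (simp only: hpoly_of_real)
  have r0: "poly r 0 = of_real R" using re[of 0] by (simp add: R_def)
  have deg: "degree r \<le> Suc d" unfolding r_def by (rule degree_hline[OF S(1)])
  have neg: "t \<in> \<real> \<and> Re t < 0" if "poly r t = 0" for t
  proof -
    have "t \<in> \<real> \<and> Re t \<le> 0"
      using that y by (intro hstable_coordinate_line_roots[OF S(2) c, of y]) (simp_all add: r z_def)
    moreover have "t \<noteq> 0" using that r0 R by auto
    ultimately show ?thesis by (auto simp: complex_is_Real_iff complex_eq_iff)
  qed
  obtain b where b: "\<And>j. b j \<ge> 0" "\<And>z. poly r z = poly r 0 * (\<Prod>j<Suc d. 1 + of_real (b j) * z)"
    "poly (pderiv r) 0 = poly r 0 * of_real (\<Sum>j<Suc d. b j)"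
    using real_roots_product[OF deg _ neg[THEN conjunct1]] r0 R neg by (metis of_real_eq_0_iff)
  have "complex_of_real (hpoly S (Suc d) c (y(i := t))) = of_real (R * (\<Prod>j<Suc d. 1 + b j * t))" for t
    using b(2)[of "of_real t"] unfolding re r0 by (simp del: prod.lessThan_Suc)
  then have 1: "hpoly S (Suc d) c (y(i := t)) = R * (\<Prod>j<Suc d. 1 + b j * t)" for t
    using of_real_eq_iff by blast
  have "poly r = (\<lambda>t. chpoly S (Suc d) c (z(i := t)))" using r by (simp add: fun_eq_iff)
  then have "(poly r has_field_derivative hpoly (S - {i}) d (slice i (\<lambda>\<alpha>. complex_of_real (c \<alpha>))) z) (at 0)"
    using slice_has_field_derivative[OF S, of d _ z] by simp
  then have "poly (pderiv r) 0 = hpoly (S - {i}) d (slice i (\<lambda>\<alpha>. complex_of_real (c \<alpha>))) z"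
    using DERIV_unique poly_DERIV by blast
  also have "\<dots> = of_real (hpoly (S - {i}) d (slice i c) y)"
    unfolding z_def slice_def[abs_def] by (rule hpoly_of_real)
  finally have "complex_of_real (hpoly (S - {i}) d (slice i c) y) = of_real (R * (\<Sum>j<Suc d. b j))"
    unfolding b(3) r0 by (simp del: sum.lessThan_Suc)
  then have "hpoly (S - {i}) d (slice i c) y = R * (\<Sum>j<Suc d. b j)"
    using of_real_eq_iff by blast
  with b(1) 1 that show ?thesis by blast
qed

section \<open>The capacity of a slice\<close>

text \<open>
  If all \<open>b j\<close> are equal, then \<open>R * (1 + b * t) ^ Suc d / t\<close> is smallest at
  \<open>t = Suc d / (d * B)\<close>; the same \<open>t\<close> works in general, because the product at that \<open>t\<close> is largest when
  all factors agree.
\<close>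

lemma slope_ge_of_product_ge:
  fixes b :: "nat \<Rightarrow> real"
  assumes b: "\<And>j. b j \<ge> 0" and R: "R > 0" and C: "C \<ge> 0"
    and ge: "\<And>t. t > 0 \<Longrightarrow> R * (\<Prod>j<Suc d. 1 + b j * t) \<ge> C * t"
  defines "B \<equiv> \<Sum>j<Suc d. b j"
  shows "R * B \<ge> (real d / real (Suc d)) ^ d * C"
    and "R * B = (real d / real (Suc d)) ^ d * C \<Longrightarrow> C > 0 \<Longrightarrow> d > 0 \<Longrightarrow>
      B > 0 \<and> (\<forall>j<Suc d. b j = B / real (Suc d))"
proof -
  have B0: "B \<ge> 0" unfolding B_def by (intro sum_nonneg b)
  have C0: "C = 0" if "B = 0"
  proof (rule ccontr)
    assume "C \<noteq> 0"
    with C have "C > 0" by simp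
    have "b j = 0" if "j < Suc d" for j
      using \<open>B = 0\<close> that b unfolding B_def by (subst (asm) sum_nonneg_eq_0_iff) auto
    then have "R \<ge> C * ((R + 1) / C)" using ge[of "(R + 1) / C"] R \<open>C > 0\<close> by simp
    with \<open>C > 0\<close> show False by simp
  qed
  have main: "R * B \<ge> (real d / real (Suc d)) ^ d * C \<and>
      (R * B = (real d / real (Suc d)) ^ d * C \<longrightarrow> (\<forall>j<Suc d. b j = B / real (Suc d)))"
    if d: "d > 0" and Bpos: "B > 0"
  proof -
    define t where "t = real (Suc d) / (real d * B)"
    define q where "q = real d / real (Suc d)"
    have tpos: "t > 0" and q: "q > 0" using d Bpos by (auto simp: t_def q_def)
    have bt: "B * t = real (Suc d) / real d" using Bpos by (simp add: t_def)
    \<comment> \<open>The factors at \<open>t\<close>, normalized to have mean \<open>1\<close>.\<close>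
    define u where "u j = q * (1 + b j * t)" for j
    have u0: "u j \<ge> 0" for j using b[of j] tpos q by (simp add: u_def)
    have "(\<Sum>j<Suc d. u j) = q * (real (Suc d) + B * t)"
      by (simp add: u_def B_def sum_distrib_left sum_distrib_right sum.distrib distrib_left distrib_right del: sum.lessThan_Suc)
    also have "\<dots> = real (Suc d)" unfolding bt using d by (simp add: q_def divide_simps) (simp add: algebra_simps)
    finally have sm: "(\<Sum>j<Suc d. u j) = card {..<Suc d}" by simp
    have pr: "(\<Prod>j<Suc d. u j) = q ^ Suc d * (\<Prod>j<Suc d. 1 + b j * t)"
      unfolding u_def prod.distrib by simp
    have scale: "q ^ Suc d * (C * t) = q ^ d * C / B"
      using d Bpos by (simp add: t_def q_def)
    have le1: "(\<Prod>j<Suc d. u j) \<le> 1"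
      by (rule prod_le_one_if_sum_eq_card(1)) (use u0 sm in auto)
    have "q ^ Suc d * (C * t) \<le> q ^ Suc d * (R * (\<Prod>j<Suc d. 1 + b j * t))"
      using ge[OF tpos] q by (intro mult_left_mono) auto
    also have "\<dots> = R * (\<Prod>j<Suc d. u j)" by (simp add: pr mult_ac del: prod.lessThan_Suc)
    finally have 1: "q ^ d * C / B \<le> R * (\<Prod>j<Suc d. u j)" unfolding scale .
    also have "\<dots> \<le> R" using le1 R by (simp del: prod.lessThan_Suc)
    finally have ineq: "q ^ d * C \<le> R * B" using Bpos by (simp add: field_simps)
    moreover have "b j = B / real (Suc d)" if eq: "R * B = q ^ d * C" and j: "j < Suc d" for j
    proof -
      have "q ^ d * C / B = R" using eq Bpos by (simp add: field_simps)
      with 1 le1 R have "(\<Prod>j<Suc d. u j) = 1" by (simp del: prod.lessThan_Suc)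
      then have "u j = 1" by (rule prod_le_one_if_sum_eq_card(2)[rotated 3]) (use u0 sm j in auto)
      then have "1 + b j * t = real (Suc d) / real d" using d by (simp add: u_def q_def field_simps)
      then have "b j * t = 1 / real d" using d by (simp add: field_simps)
      then have "b j = 1 / real d / t" using tpos by (subst nonzero_eq_divide_eq) simp_all
      then show ?thesis using d Bpos by (simp add: t_def)
    qed
    ultimately show ?thesis by (simp add: q_def)
  qed
  show "R * B \<ge> (real d / real (Suc d)) ^ d * C"
  proof (cases "B = 0 \<or> d > 0")
    case True
    then show ?thesis using C0 main B0 by (cases "B = 0") auto
  next
    case False
    then have "d = 0" "B > 0" using B0 by auto
    show ?thesis
    proof (rule ccontr)
      assume "\<not> ?thesis"
      then have lt: "R * b 0 < C" using \<open>d = 0\<close> by (simp add: B_def)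
      define t where "t = 2 * R / (C - R * b 0)"
      have "t > 0" using lt R by (simp add: t_def)
      from ge[OF this] \<open>d = 0\<close> have "t * (C - R * b 0) \<le> R" by (simp add: algebra_simps)
      moreover have "t * (C - R * b 0) = 2 * R" using lt by (simp add: t_def)
      ultimately show False using R by simp
    qed
  qed
  show "B > 0 \<and> (\<forall>j<Suc d. b j = B / real (Suc d))"
    if "R * B = (real d / real (Suc d)) ^ d * C" "C > 0" "d > 0"
    using that main C0 B0 by (cases "B = 0") auto
qed

text \<open>
  If the polynomial vanishes at \<open>t = 0\<close>, its slope there is at least \<open>C\<close> itself, which is more than needed
  and excludes equality for \<open>d > 0\<close>. Otherwise the slope is \<open>R * (\<Sum>j. b j)\<close>.
\<close>

lemma slice_capacity:
  assumes S: "finite S" "i \<in> S" and c: "hstable S (Suc d) c"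
    and y: "\<And>j. j \<in> S - {i} \<Longrightarrow> y j > 0" and C: "C \<ge> 0"
    and ge: "\<And>t. t > 0 \<Longrightarrow> hpoly S (Suc d) c (y(i := t)) \<ge> C * t"
  shows "hpoly (S - {i}) d (slice i c) y \<ge> (real d / real (Suc d)) ^ d * C"
    and "hpoly (S - {i}) d (slice i c) y = (real d / real (Suc d)) ^ d * C \<Longrightarrow> C > 0 \<Longrightarrow> d > 0 \<Longrightarrow>
      \<exists>R>0. \<exists>b>0. \<forall>t. hpoly S (Suc d) c (y(i := t)) = R * (1 + b * t) ^ Suc d"
proof -
  define R where "R = hpoly S (Suc d) c (y(i := 0))"
  let ?D = "hpoly (S - {i}) d (slice i c) y"
  have R0: "R \<ge> 0" unfolding R_def using y by (intro hstable_nonneg[OF c]) (auto intro: less_imp_le)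
  have zero: "?D \<ge> C" if "R = 0"
  proof -
    have "((\<lambda>t. hpoly S (Suc d) c (y(i := t)) / t) \<longlongrightarrow> ?D) (at_right 0)"
      using slice_has_field_derivative[OF S, of d c y] that[unfolded R_def]
      by (auto simp: has_field_derivative_iff filterlim_at_split)
    moreover have "\<forall>\<^sub>F t in at_right 0. C \<le> hpoly S (Suc d) c (y(i := t)) / t"
      using eventually_at_right_less[of 0]
      by eventually_elim (use ge in \<open>simp add: pos_le_divide_eq\<close>)
    ultimately show ?thesis using tendsto_lowerbound by fastforce
  qed
  have q1: "(real d / real (Suc d)) ^ d \<le> 1" by (intro power_le_one) auto
  show "?D \<ge> (real d / real (Suc d)) ^ d * C"
  proof (cases "R = 0")
    case True
    then show ?thesis using zero mult_right_mono[OF q1 C] by simp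
  next
    case False
    obtain b where b: "\<And>j. b j \<ge> 0" "\<And>t. hpoly S (Suc d) c (y(i := t)) = R * (\<Prod>j<Suc d. 1 + b j * t)"
        "?D = R * (\<Sum>j<Suc d. b j)"
      using hstable_coordinate_line_product[OF S c y R_def False] by blast
    have "R > 0" using False R0 by simp
    from slope_ge_of_product_ge(1)[where b = b and d = d, OF b(1) this C] show ?thesis
      using ge b(2,3) by simp
  qed
  assume eq: "?D = (real d / real (Suc d)) ^ d * C" and pos: "C > 0" "d > 0"
  have "(real d / real (Suc d)) ^ d < 1" using pos by (intro power_less_one_iff[THEN iffD2]) auto
  then have "?D < C" using pos eq by simp
  with zero have False: "R \<noteq> 0" by linarith
  obtain b where b: "\<And>j. b j \<ge> 0" "\<And>t. hpoly S (Suc d) c (y(i := t)) = R * (\<Prod>j<Suc d. 1 + b j * t)"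
      "?D = R * (\<Sum>j<Suc d. b j)"
    using hstable_coordinate_line_product[OF S c y R_def False] by blast
  have Rpos: "R > 0" using False R0 by simp
  define B where "B = (\<Sum>j<Suc d. b j)"
  have "B > 0 \<and> (\<forall>j<Suc d. b j = B / real (Suc d))"
    unfolding B_def
    by (rule slope_ge_of_product_ge(2)[where b = b and d = d, OF b(1) Rpos C]) (use ge b(2) eq[unfolded b(3)] pos in auto)
  then have "hpoly S (Suc d) c (y(i := t)) = R * (1 + B / real (Suc d) * t) ^ Suc d" "B / real (Suc d) > 0" for t
    unfolding b(2) by (auto simp del: prod.lessThan_Suc power_Suc)
  then show "\<exists>R>0. \<exists>b>0. \<forall>t. hpoly S (Suc d) c (y(i := t)) = R * (1 + b * t) ^ Suc d"
    using Rpos by blast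
qed

lemma prod_fun_upd: "finite S \<Longrightarrow> i \<in> S \<Longrightarrow> (\<Prod>j\<in>S. (y(i := t)) j) = t * (\<Prod>j\<in>S - {i}. y j :: real)"
  by (subst prod.remove[of S i]) (auto intro!: prod.cong)

lemma capacity_slice_bound:
  assumes S: "finite S" "i \<in> S" and c: "hstable S (Suc d) c" and C: "C \<ge> 0"
    and ge: "\<And>x. (\<And>j. j \<in> S \<Longrightarrow> x j > 0) \<Longrightarrow> hpoly S (Suc d) c x \<ge> C * (\<Prod>j\<in>S. x j)"
    and y: "\<And>j. j \<in> S - {i} \<Longrightarrow> y j > 0"
  shows "hpoly (S - {i}) d (slice i c) y \<ge> (real d / real (Suc d)) ^ d * C * (\<Prod>j\<in>S - {i}. y j)"
    and "hpoly (S - {i}) d (slice i c) y = (real d / real (Suc d)) ^ d * C * (\<Prod>j\<in>S - {i}. y j) \<Longrightarrow>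
      C > 0 \<Longrightarrow> d > 0 \<Longrightarrow> \<exists>R>0. \<exists>b>0. \<forall>t. hpoly S (Suc d) c (y(i := t)) = R * (1 + b * t) ^ Suc d"
proof -
  let ?p = "\<Prod>j\<in>S - {i}. y j"
  have p: "?p > 0" using y by (intro prod_pos) auto
  have ge': "hpoly S (Suc d) c (y(i := t)) \<ge> (C * ?p) * t" if "t > 0" for t
  proof -
    have "C * (\<Prod>j\<in>S. (y(i := t)) j) \<le> hpoly S (Suc d) c (y(i := t))"
      using that y by (intro ge) auto
    then show ?thesis by (simp only: prod_fun_upd[OF S] mult_ac)
  qed
  note * = slice_capacity[OF S c y _ ge']
  have Cp: "C * ?p \<ge> 0" using C p by simp
  show "hpoly (S - {i}) d (slice i c) y \<ge> (real d / real (Suc d)) ^ d * C * ?p"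
    using *(1)[OF _ Cp] by (simp only: mult.assoc)
  show "\<exists>R>0. \<exists>b>0. \<forall>t. hpoly S (Suc d) c (y(i := t)) = R * (1 + b * t) ^ Suc d"
    if "hpoly (S - {i}) d (slice i c) y = (real d / real (Suc d)) ^ d * C * ?p" "C > 0" "d > 0"
    using *(2)[OF _ Cp] that p by (simp only: mult.assoc mult_pos_pos)
qed

lemma fact_div_power_Suc:
  "fact (Suc d) / real (Suc d) ^ Suc d = fact d / real d ^ d * (real d / real (Suc d)) ^ d"
  by (cases "d = 0") (simp_all add: power_divide del: of_nat_Suc)

lemma hstable_capacity_slice:
  assumes S: "finite S" "i \<in> S" and c: "hstable S (Suc d) c" and C: "C > 0"
    and ge: "\<And>x. (\<And>j. j \<in> S \<Longrightarrow> x j > 0) \<Longrightarrow> hpoly S (Suc d) c x \<ge> C * (\<Prod>j\<in>S. x j)"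
  shows "hstable (S - {i}) d (slice i c)"
proof (rule hstable_slice[OF S c])
  fix y :: "'a \<Rightarrow> real" assume y: "\<And>j. j \<in> S - {i} \<Longrightarrow> y j > 0"
  have "0 < (real d / real (Suc d)) ^ d * C * (\<Prod>j\<in>S - {i}. y j)"
    using y C by (cases "d = 0") (auto intro!: prod_pos mult_pos_pos)
  also have "\<dots> \<le> hpoly (S - {i}) d (slice i c) y"
    using capacity_slice_bound(1)[OF S c less_imp_le[OF C] ge y] by simp
  finally show "hpoly (S - {i}) d (slice i c) y > 0" .
qed

section \<open>The capacity bounds the mixed coefficient\<close>

text \<open>
  The last hypothesis says that the capacity is at least \<open>C\<close>, in a form without the constraint that the
  product of the variables is \<open>1\<close>. It therefore restricts to slices at once.
\<close>

theorem mixed_coeff_ge_capacity: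
  assumes "finite S" "hstable S (card S) c" "C > 0"
    "\<And>x. (\<And>j. j \<in> S \<Longrightarrow> x j > 0) \<Longrightarrow> hpoly S (card S) c x \<ge> C * (\<Prod>j\<in>S. x j)"
  shows "c (ones S) \<ge> fact (card S) / real (card S) ^ card S * C"
  using assms
proof (induction S arbitrary: c C)
  case empty
  then show ?case by (simp add: hpoly_degree_0 ones_def)
next
  case (insert i S)
  define d where "d = card S"
  let ?T = "insert i S" and ?C = "(real d / real (Suc d)) ^ d * C"
  have k: "card ?T = Suc d" and T: "finite ?T" "i \<in> ?T" and Si: "?T - {i} = S"
    using insert.hyps by (auto simp: d_def)
  have c: "hstable ?T (Suc d) c" using insert.prems(1) by (simp add: k)
  note ge = insert.prems(3)[unfolded k]
  have C': "?C > 0" using insert.prems(2) by (cases "d = 0") auto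
  have "slice i c (ones S) \<ge> fact (card S) / real (card S) ^ card S * ?C"
  proof (rule insert.IH)
    show "hstable S (card S) (slice i c)"
      using hstable_capacity_slice[OF T c insert.prems(2) ge] by (simp only: Si d_def)
    show "hpoly S (card S) (slice i c) x \<ge> ?C * (\<Prod>j\<in>S. x j)" if "\<And>j. j \<in> S \<Longrightarrow> x j > 0" for x
      using capacity_slice_bound(1)[OF T c less_imp_le[OF insert.prems(2)] ge, of x] that
      by (simp only: Si d_def)
  qed (fact C')
  then show ?case
    using slice_ones[OF T(2), of c] unfolding k fact_div_power_Suc Si d_def by (simp only: mult.assoc)
qed

text \<open>
  This covers capacity zero, where a slice may vanish and the induction on slices would stop. Deriving
  instead in the strictly positive directions \<open>e\<^sub>i + \<epsilon> (1, \<dots>, 1)\<close> keeps the polynomial stable, so the final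
  constant is positive, and it tends to the mixed coefficient.
\<close>

lemma mixed_coeff_nonneg:
  fixes S :: "'a set"
  assumes S: "finite S" and c: "hstable S (card S) c"
  shows "c (ones S) \<ge> 0"
proof -
  obtain vs where vs: "set vs = S" "distinct vs" using finite_distinct_list[OF S] by blast
  define w :: "real \<Rightarrow> 'a \<Rightarrow> 'a \<Rightarrow> real"
    where "w = (\<lambda>\<epsilon> i j. (if j = i then 1 else 0) + \<epsilon>)"
  define D where "D = (\<lambda>\<epsilon> us. foldr (\<lambda>i. dir_deriv S (w \<epsilon> i)) us c)"
  have lim: "((\<lambda>\<epsilon>. D \<epsilon> us \<alpha>) \<longlongrightarrow> foldr pd_coeffs us c \<alpha>) (at_right 0)" if "set us \<subseteq> S" for us \<alpha>
    using that
  proof (induction us arbitrary: \<alpha>)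
    case Nil
    then show ?case by (simp add: D_def)
  next
    case (Cons i us)
    have "((\<lambda>\<epsilon>. pd_coeffs j (D \<epsilon> us) \<alpha>) \<longlongrightarrow> pd_coeffs j (foldr pd_coeffs us c) \<alpha>) (at_right 0)" for j
      unfolding pd_coeffs_def[of j] using Cons by (intro tendsto_intros) auto
    then have "((\<lambda>\<epsilon>. \<Sum>j\<in>S. w \<epsilon> i j * pd_coeffs j (D \<epsilon> us) \<alpha>) \<longlongrightarrow>
        (\<Sum>j\<in>S. w 0 i j * pd_coeffs j (foldr pd_coeffs us c) \<alpha>)) (at_right 0)"
      unfolding w_def by (intro tendsto_intros)
    also have "(\<Sum>j\<in>S. w 0 i j * pd_coeffs j (foldr pd_coeffs us c) \<alpha>) = foldr pd_coeffs (i # us) c \<alpha>"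
      using Cons.prems S by (simp add: w_def if_distrib if_distribR cong: if_cong)
    finally show ?case by (simp add: D_def dir_deriv_def)
  qed
  have stab: "hstable S (card S - length us) (D \<epsilon> us)" if "\<epsilon> > 0" "length us \<le> card S" for \<epsilon> us
    using that(2)
  proof (induction us)
    case Nil
    then show ?case using c by (simp add: D_def)
  next
    case (Cons i us)
    have "hstable S (Suc (card S - length (i # us))) (D \<epsilon> us)"
      using Cons by (simp add: Suc_diff_Suc)
    then show ?case
      unfolding D_def foldr.simps o_def
      by (rule hstable_dir_deriv[OF S]) (use that(1) in \<open>simp add: w_def add_pos_nonneg\<close>)
  qed
  have "\<forall>\<^sub>F \<epsilon> in at_right 0. 0 \<le> D \<epsilon> vs (\<lambda>_. 0)"
    using eventually_at_right_less[of 0]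
  proof eventually_elim
    case (elim \<epsilon>)
    then have "hstable S 0 (D \<epsilon> vs)"
      using stab[of \<epsilon> vs] vs by (simp add: distinct_card[symmetric])
    from hstable_pos[OF this, of "\<lambda>_. 1"] show ?case by (simp add: hpoly_degree_0 S)
  qed
  with lim[of vs "\<lambda>_. 0"] vs have "0 \<le> foldr pd_coeffs vs c (\<lambda>_. 0)"
    using tendsto_lowerbound by fastforce
  also have "\<dots> = c (ones S)"
    using vs by (subst foldr_pd_coeffs) (auto simp: ones_def)
  finally show ?thesis .
qed

section \<open>Directions along which a stable polynomial is constant\<close>

text \<open>
  Along a line through the positive point \<open>e\<close> the polynomial is \<open>P(e) * \<Prod>j. (1 + b j * t)\<close> with real
  \<open>b j\<close>, and \<open>N w\<close> is \<open>P(e)\<^sup>2\<close> times the sum of their squares. The value at \<open>w\<close> is the top coefficient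
  \<open>P(e) * \<Prod>j. b j\<close>, which that sum controls.
\<close>

lemma hstable_line_sum_squares:
  assumes S: "finite S" and c: "hstable S d c" and e: "\<And>i. i \<in> S \<Longrightarrow> e i > 0"
  defines "p w \<equiv> hline S d c e w"
  defines "N w \<equiv> (coeff (p w) 1)\<^sup>2 - 2 * hpoly S d c e * coeff (p w) 2"
  shows "N w \<ge> 0" "\<bar>hpoly S d c w\<bar> \<le> hpoly S d c e * (sqrt (N w) / hpoly S d c e) ^ d"
proof -
  let ?L = "hpoly S d c e"
  have L: "?L > 0" by (rule hstable_pos[OF c e])
  let ?r = "map_poly complex_of_real (p w)"
  have r: "?r = hline S d (\<lambda>\<alpha>. complex_of_real (c \<alpha>)) (\<lambda>i. of_real (e i)) (\<lambda>i. of_real (w i))"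
    by (simp add: p_def hline_of_real)
  have deg: "degree ?r \<le> d" unfolding r by (rule degree_hline[OF S])
  have r0: "poly ?r 0 = of_real ?L" by (simp add: r hpoly_of_real)
  have real: "t \<in> \<real>" if "poly ?r t = 0" for t
  proof (cases "t = 0")
    case False
    have "(\<lambda>i. complex_of_real (e i) + t * of_real (w i)) =
        (\<lambda>i. t * (of_real (w i) + inverse t * of_real (e i)))"
      using False by (simp add: fun_eq_iff distrib_left flip: mult.assoc)
    with that have "t ^ d * chpoly S d c (\<lambda>i. of_real (w i) + inverse t * of_real (e i)) = 0"
      by (simp only: r poly_hline hpoly_scale)
    then have "inverse t \<in> \<real>"
      by (intro hstable_real_rooted[OF c e]) (use False in simp_all)
    then show ?thesis using Reals_inverse[of "inverse t"] by simp
  qed simp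
  have "poly ?r 0 \<noteq> 0" using r0 L by simp
  from real_roots_product[OF deg this real]
  obtain b where b: "\<And>z. poly ?r z = poly ?r 0 * (\<Prod>j<d. 1 + of_real (b j) * z)"
    by metis
  have "poly (p w) t = ?L * (\<Prod>j<d. 1 + b j * t)" for t
  proof -
    have "complex_of_real (poly (p w) t) = of_real (?L * (\<Prod>j<d. 1 + b j * t))"
      using b[of "of_real t"] unfolding r0 poly_map_of_real by simp
    then show ?thesis using of_real_eq_iff by blast
  qed
  then have p: "p w = smult ?L (\<Prod>j<d. [:1, b j:])"
    by (intro poly_eqI_infinite[OF infinite_UNIV_char_0]) (simp add: poly_prod mult_ac)
  have N: "N w = ?L\<^sup>2 * (\<Sum>j<d. (b j)\<^sup>2)"
  proof -
    let ?q = "\<Prod>j<d. [:1, b j:]"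
    have "N w = ?L\<^sup>2 * ((coeff ?q 1)\<^sup>2 - 2 * coeff ?q 2)"
      unfolding N_def p coeff_smult by (simp only: power2_eq_square algebra_simps)
    then show ?thesis by (simp only: coeffs_prod_linear) simp
  qed
  then show N0: "N w \<ge> 0" by (simp add: sum_nonneg)
  have s: "sqrt (N w) / ?L = sqrt (\<Sum>j<d. (b j)\<^sup>2)"
    using L by (simp add: N real_sqrt_mult)
  have bj: "\<bar>b j\<bar> \<le> sqrt (\<Sum>j<d. (b j)\<^sup>2)" if "j < d" for j
    using that by (intro real_le_rsqrt) (auto intro: member_le_sum)
  have "hpoly S d c w = ?L * (\<Prod>j<d. b j)"
    using coeff_hline[OF S, of d c e w] coeffs_prod_linear(5)[of b d] unfolding p_def[symmetric] p by simp
  then have "\<bar>hpoly S d c w\<bar> = ?L * (\<Prod>j<d. \<bar>b j\<bar>)"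
    using L by (simp add: abs_mult abs_prod)
  also have "\<dots> \<le> ?L * (\<Prod>j<d. sqrt (\<Sum>j<d. (b j)\<^sup>2))"
    using L bj by (intro mult_left_mono prod_mono) auto
  finally show "\<bar>hpoly S d c w\<bar> \<le> ?L * (sqrt (N w) / ?L) ^ d" by (simp add: s)
qed

text \<open>
  Constancy along one line through a positive point already gives constancy along all parallel lines.
  The quantity \<open>N\<close> of the preceding lemma is a polynomial in \<open>\<epsilon>\<close> at \<open>v + \<epsilon> x\<close>, nonnegative everywhere and
  zero at \<open>\<epsilon> = 0\<close>; so it is divisible by \<open>\<epsilon>\<^sup>2\<close>, and the value at \<open>v + \<epsilon> x\<close> is of order \<open>\<epsilon> ^ d\<close>. By homogeneity
  with \<open>\<epsilon> = 1 / s\<close>, the value at \<open>x + s v\<close> stays bounded as \<open>s\<close> grows, and a bounded polynomial in \<open>s\<close> is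
  constant.
\<close>

lemma hstable_lineality:
  fixes x :: "'a \<Rightarrow> real"
  assumes S: "finite S" and c: "hstable S d c" and e: "\<And>i. i \<in> S \<Longrightarrow> e i > 0"
    and v: "\<And>t. hpoly S d c (\<lambda>i. e i + t * v i) = hpoly S d c e"
  shows "hpoly S d c (\<lambda>i. x i + s * v i) = hpoly S d c x"
proof -
  let ?L = "hpoly S d c e"
  have L: "?L > 0" by (rule hstable_pos[OF c e])
  define N where "N w = (coeff (hline S d c e w) 1)\<^sup>2 - 2 * ?L * coeff (hline S d c e w) 2" for w
  have N: "N w \<ge> 0" "\<bar>hpoly S d c w\<bar> \<le> ?L * (sqrt (N w) / ?L) ^ d" for w
    using hstable_line_sum_squares[OF S c, of e w] e by (simp_all add: N_def)
  have "hline S d c e v = [:?L:]"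
    by (rule poly_eqI_infinite[OF infinite_UNIV_char_0]) (simp add: v)
  then have Nv: "N v = 0" by (simp add: N_def numeral_2_eq_2)
  obtain g1 where g1: "\<And>\<epsilon>. coeff (hline S d c e (\<lambda>i. v i + \<epsilon> * x i)) 1 = poly g1 \<epsilon>"
    using coeff_hline_affine[of S d c e v x 1] by blast
  obtain g2 where g2: "\<And>\<epsilon>. coeff (hline S d c e (\<lambda>i. v i + \<epsilon> * x i)) 2 = poly g2 \<epsilon>"
    using coeff_hline_affine[of S d c e v x 2] by blast
  define g where "g = g1\<^sup>2 - smult (2 * ?L) g2"
  have g: "poly g \<epsilon> = N (\<lambda>i. v i + \<epsilon> * x i)" for \<epsilon>
    unfolding g_def N_def g1 g2 by simp
  obtain h where h: "g = [:0, 0, 1:] * h"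
    by (rule nonneg_poly_double_root[of g]) (use g[of 0] N(1) Nv in \<open>auto simp: g\<close>)
  have bound: "\<bar>hpoly S d c (\<lambda>i. x i + s * v i)\<bar> \<le> ?L * (sqrt (poly h (inverse s)) / ?L) ^ d" if "s \<noteq> 0" for s
  proof -
    let ?y = "\<lambda>i. v i + inverse s * x i"
    have "N ?y = (inverse s)\<^sup>2 * poly h (inverse s)"
      unfolding g[symmetric] h by (simp add: power2_eq_square)
    then have sq: "sqrt (N ?y) = \<bar>inverse s\<bar> * sqrt (poly h (inverse s))"
      by (simp add: real_sqrt_mult)
    have "(\<lambda>i. x i + s * v i) = (\<lambda>i. s * ?y i)"
      using that by (simp add: fun_eq_iff distrib_left flip: mult.assoc)
    then have "\<bar>hpoly S d c (\<lambda>i. x i + s * v i)\<bar> = \<bar>s\<bar> ^ d * \<bar>hpoly S d c ?y\<bar>"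
      by (simp only: hpoly_scale abs_mult power_abs)
    also have "\<dots> \<le> \<bar>s\<bar> ^ d * (?L * (sqrt (N ?y) / ?L) ^ d)"
      using N(2) by (intro mult_left_mono) auto
    also have "\<dots> = ?L * (\<bar>s\<bar> * \<bar>inverse s\<bar> * sqrt (poly h (inverse s)) / ?L) ^ d"
      by (simp add: sq power_mult_distrib power_divide mult_ac)
    also have "\<bar>s\<bar> * \<bar>inverse s\<bar> = 1" using that by (simp flip: abs_mult)
    finally show ?thesis by simp
  qed
  let ?p = "hline S d c x v"
  have "degree ?p = 0"
  proof (rule ccontr)
    assume "degree ?p \<noteq> 0"
    then have "filterlim (poly ?p) at_infinity at_infinity"
      by (intro filterlim_poly_at_infinity) simp
    then have "filterlim (poly ?p) at_infinity at_top"
      using filterlim_mono at_top_le_at_infinity by blast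
    then have "filterlim (\<lambda>s. norm (poly ?p s)) at_top at_top"
      by (rule filterlim_at_infinity_imp_norm_at_top)
    moreover have "((\<lambda>s. ?L * (sqrt (poly h (inverse s)) / ?L) ^ d) \<longlongrightarrow>
        ?L * (sqrt (poly h 0) / ?L) ^ d) at_top"
      using L by (intro tendsto_intros tendsto_inverse_0_at_top filterlim_ident) auto
    then have "\<forall>\<^sub>F s in at_top. ?L * (sqrt (poly h (inverse s)) / ?L) ^ d < ?L * (sqrt (poly h 0) / ?L) ^ d + 1"
      by (rule order_tendstoD) simp
    ultimately have "\<forall>\<^sub>F s in at_top. s > 0 \<and> norm (poly ?p s) \<ge> ?L * (sqrt (poly h 0) / ?L) ^ d + 1 \<and>
        ?L * (sqrt (poly h (inverse s)) / ?L) ^ d < ?L * (sqrt (poly h 0) / ?L) ^ d + 1"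
      by (intro eventually_conj eventually_gt_at_top) (auto simp: filterlim_at_top)
    then obtain s where "s > 0" "norm (poly ?p s) \<ge> ?L * (sqrt (poly h 0) / ?L) ^ d + 1"
        "?L * (sqrt (poly h (inverse s)) / ?L) ^ d < ?L * (sqrt (poly h 0) / ?L) ^ d + 1"
      using eventually_happens'[OF trivial_limit_at_top_linorder] by blast
    with bound[of s] show False by simp
  qed
  then obtain a where "?p = [:a:]" by (rule degree_eq_zeroE)
  then have "poly ?p s = poly ?p 0" by simp
  then show ?thesis by simp
qed

section \<open>The equality case\<close>

text \<open>
  On the plane spanned by \<open>y\<close> and the \<open>i\<close>-th axis the polynomial is a power of a linear form. The form
  vanishes in the direction \<open>y(i := - 1 / b)\<close>, so the polynomial is constant along that line through
  \<open>y(i := 1)\<close>.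
\<close>

lemma invariant_along_root_of_line_power:
  assumes T: "finite T" "i \<in> T" and c: "hstable T k c"
    and y: "\<And>j. j \<in> T - {i} \<Longrightarrow> y j > 0" and b: "b > 0"
    and line: "\<And>t. hpoly T k c (y(i := t)) = R * (1 + b * t) ^ k"
  shows "hpoly T k c (\<lambda>j. x j + s * (y(i := - 1 / b)) j) = hpoly T k c x"
proof (rule hstable_lineality[OF T(1) c, of "y(i := 1)"])
  show "(y(i := 1)) j > 0" if "j \<in> T" for j using y[of j] that by auto
  show "hpoly T k c (\<lambda>j. (y(i := 1)) j + t * (y(i := - 1 / b)) j) = hpoly T k c (y(i := 1))" for t
  proof -
    let ?p = "hline T k c (y(i := 1)) (y(i := - 1 / b))"
    have "?p = [:R * (1 + b) ^ k:]"
    proof (rule poly_eqI_infinite[of "- {- 1}"])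
      \<comment> \<open>The excluded parameter \<open>- 1\<close> is where the scaling by \<open>1 + t\<close> breaks down.\<close>
      show "infinite (- {- 1 :: real})" using infinite_UNIV_char_0 finite_compl[of "{- 1 :: real}"] by simp
      fix t :: real assume "t \<in> - {- 1}"
      then have t: "1 + t \<noteq> 0" by auto
      have "(\<lambda>j. (y(i := 1)) j + t * (y(i := - 1 / b)) j) = (\<lambda>j. (1 + t) * (y(i := (1 - t / b) / (1 + t))) j)"
      proof
        fix j
        show "(y(i := 1)) j + t * (y(i := - 1 / b)) j = (1 + t) * (y(i := (1 - t / b) / (1 + t))) j"
          using t by (cases "j = i") (simp, simp add: distrib_right)
      qed
      then have "poly ?p t = (1 + t) ^ k * hpoly T k c (y(i := (1 - t / b) / (1 + t)))"
        by (simp only: poly_hline hpoly_scale)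
      also have "\<dots> = R * ((1 + t) * (1 + b * ((1 - t / b) / (1 + t)))) ^ k"
        unfolding line by (simp only: power_mult_distrib mult_ac)
      also have "(1 + t) * (1 + b * ((1 - t / b) / (1 + t))) = 1 + b"
      proof -
        have "(1 + t) * (1 + b * (q / (1 + t))) = 1 + t + b * q" for q
          using t by (simp add: distrib_left)
        then have "(1 + t) * (1 + b * ((1 - t / b) / (1 + t))) = 1 + t + b * (1 - t / b)" .
        then show ?thesis using b by (simp only: right_diff_distrib) simp
      qed
      finally show "poly ?p t = poly [:R * (1 + b) ^ k:] t" by simp
    qed
    then have "poly ?p t = R * (1 + b) ^ k" by simp
    then show ?thesis by (simp only: poly_hline line mult_1_right)
  qed
qed

text \<open>
  By the invariance along \<open>y(i := - 1 / b)\<close>, the derivative by \<open>x\<^sub>i\<close> at any point equals the slice at a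
  point shifted along \<open>y\<close>, where it is a known power. Integration determines the polynomial up to a term
  \<open>A\<close> independent of \<open>x\<^sub>i\<close>, and real-rootedness excludes \<open>A \<noteq> 0\<close>.
\<close>

lemma power_linear_if_slice_power:
  assumes S: "finite S" "i \<notin> S" "S \<noteq> {}"
  defines "T \<equiv> insert i S" and "d \<equiv> card S"
  assumes c: "hstable T (Suc d) c"
    and a: "\<And>j. j \<in> S \<Longrightarrow> a j > 0"
    and slice: "\<And>x. hpoly S d (slice i c) x = (\<Sum>j\<in>S. a j * x j) ^ d"
    and b: "b > 0"
    and line: "\<And>t. hpoly T (Suc d) c ((\<lambda>j. inverse (a j))(i := t)) = R * (1 + b * t) ^ Suc d"
  shows "hpoly T (Suc d) c x = ((\<Sum>j\<in>S. a j * x j) + b * d * x i) ^ Suc d / (b * d * Suc d)"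
proof -
  define y where "y = (\<lambda>j. inverse (a j))"
  define \<beta> where "\<beta> = b * d"
  let ?P = "hpoly T (Suc d) c"
  define l where "l x = (\<Sum>j\<in>S. a j * x j)" for x
  have T: "finite T" "i \<in> T" "T - {i} = S" using S by (auto simp: T_def)
  have d: "d > 0" using S by (simp add: d_def card_gt_0_iff)
  have \<beta>: "\<beta> > 0" using b d by (simp add: \<beta>_def)
  have y: "y j > 0" if "j \<in> S" for j using a[OF that] by (simp add: y_def)
  have "a j * y j = 1" if "j \<in> S" for j using a[OF that] by (simp add: y_def)
  then have ly: "l y = d" by (simp add: l_def d_def)
  have l_upd: "l (x(i := t)) = l x" for x t
    unfolding l_def using S(2) by (intro sum.cong) auto
  have l_add: "l (\<lambda>j. x j + s * y j) = l x + s * d" for x s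
    using ly by (simp add: l_def sum.distrib distrib_left sum_distrib_left mult_ac flip: ly)
  have inv: "?P (\<lambda>j. x j + s * (y(i := - 1 / b)) j) = ?P x" for x s
    by (rule invariant_along_root_of_line_power[OF T(1,2) c, where R = R])
      (use y b line T in \<open>auto simp: y_def\<close>)
  have shift: "?P (x(i := t + h)) = ?P ((\<lambda>j. x j + b * t * y j)(i := h))" for x t h
  proof -
    have "(\<lambda>j. (x(i := t + h)) j + b * t * (y(i := - 1 / b)) j) = (\<lambda>j. x j + b * t * y j)(i := h)"
      using b by (auto simp: fun_eq_iff)
    then show ?thesis using inv[of "x(i := t + h)" "b * t"] by simp
  qed
  have deriv: "((\<lambda>t. ?P (x(i := t))) has_field_derivative (l x + \<beta> * t) ^ d) (at t)" for x t
  proof -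
    have "((\<lambda>h. ?P ((\<lambda>j. x j + b * t * y j)(i := h))) has_field_derivative
        hpoly (T - {i}) d (slice i c) (\<lambda>j. x j + b * t * y j)) (at 0)"
      by (rule slice_has_field_derivative[OF T(1,2)])
    also have "hpoly (T - {i}) d (slice i c) (\<lambda>j. x j + b * t * y j) = (l x + \<beta> * t) ^ d"
      unfolding T(3) slice l_def[symmetric] l_add by (simp add: \<beta>_def mult_ac)
    finally have "((\<lambda>h. ?P (x(i := t + h))) has_field_derivative (l x + \<beta> * t) ^ d) (at 0)"
      by (simp only: shift)
    then show ?thesis using DERIV_shift[of "\<lambda>t. ?P (x(i := t))" _ 0 t] by (simp add: add.commute)
  qed
  define A where "A x = ?P (x(i := 0)) - l x ^ Suc d / (\<beta> * Suc d)" for x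
  have PA: "?P (x(i := t)) = A x + (l x + \<beta> * t) ^ Suc d / (\<beta> * Suc d)" for x t
  proof -
    let ?g = "\<lambda>t. ?P (x(i := t)) - (l x + \<beta> * t) ^ Suc d / (\<beta> * Suc d)"
    have "(?g has_field_derivative 0) (at t)" for t
    proof -
      have "((\<lambda>t. (l x + \<beta> * t) ^ Suc d / (\<beta> * Suc d)) has_field_derivative (l x + \<beta> * t) ^ d) (at t)"
        using \<beta> by (auto intro!: derivative_eq_intros simp del: of_nat_Suc power_Suc)
      from DERIV_diff[OF deriv[of x t] this] show ?thesis by (simp only: diff_self)
    qed
    then have "\<forall>t. (?g has_field_derivative 0) (at t)" by blast
    then have "?g t = ?g 0" by (rule DERIV_isconst_all)
    then show ?thesis by (simp add: A_def)
  qed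
  have A0: "A x = 0" if x: "\<And>j. j \<in> S \<Longrightarrow> x j > 0" for x
  proof (cases "d > 1")
    case True
    \<comment> \<open>If \<open>A x \<noteq> 0\<close>, then the roots in the sliced variable are affine images of the roots of
      \<open>w ^ Suc d = D\<close>, not all of which are real.\<close>
    show ?thesis
    proof (rule ccontr)
      assume "A x \<noteq> 0"
      define D where "D = - A x * (\<beta> * Suc d)"
      have "D \<noteq> 0" using \<open>A x \<noteq> 0\<close> \<beta> by (simp add: D_def del: of_nat_Suc)
      then obtain w :: complex where w: "w ^ Suc d = of_real D" "w \<notin> \<real>"
        using nonreal_root_of_real[of "Suc d" D] True by auto
      let ?z = "\<lambda>j. complex_of_real (x j)"
      define t where "t = (w - of_real (l x)) / of_real \<beta>"
      define r where "r = hline T (Suc d) (\<lambda>\<alpha>. complex_of_real (c \<alpha>)) (?z(i := 0)) (\<lambda>j. if j = i then 1 else 0)"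
      define q :: "complex poly" where "q = [:of_real (A x):] + smult (of_real (inverse (\<beta> * Suc d))) ([:of_real (l x), of_real \<beta>:] ^ Suc d)"
      have "(\<lambda>j. (?z(i := 0)) j + t * (if j = i then 1 else 0)) = ?z(i := t)" for t by auto
      then have r: "poly r t = chpoly T (Suc d) c (?z(i := t))" for t by (simp add: r_def)
      have "r = q"
      proof (rule complex_poly_eqI_reals)
        fix t :: real
        have "?z(i := of_real t) = (\<lambda>j. of_real ((x(i := t)) j))" by auto
        then have "poly r (of_real t) = of_real (?P (x(i := t)))" by (simp only: r hpoly_of_real)
        also have "\<dots> = poly q (of_real t)"
          unfolding PA q_def by (simp add: divide_inverse mult_ac del: power_Suc)
        finally show "poly r (of_real t) = poly q (of_real t)" .
      qed
      moreover have "poly q t = 0"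
      proof -
        have "of_real (l x) + t * of_real \<beta> = w" using \<beta> by (simp add: t_def)
        then have "poly q t = of_real (A x) + of_real (inverse (\<beta> * Suc d)) * of_real D"
          by (simp add: q_def w(1)[symmetric] del: of_real_inverse of_real_mult power_Suc)
        also have "\<dots> = of_real (A x + inverse (\<beta> * Suc d) * D)" by (simp only: of_real_add of_real_mult)
        also have "A x + inverse (\<beta> * Suc d) * D = 0" using \<beta> by (simp add: D_def field_simps del: of_nat_Suc)
        finally show ?thesis by simp
      qed
      ultimately have "chpoly T (Suc d) c (?z(i := t)) = 0" by (simp flip: r)
      then have "t \<in> \<real>" using hstable_coordinate_line_roots[OF T(2) c, of x t] x T(3) by simp
      moreover have "w = of_real \<beta> * t + of_real (l x)" using \<beta> by (simp add: t_def)
      ultimately show False using w(2) by simp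
    qed
  next
    case False
    \<comment> \<open>With a single further variable, \<open>x\<close> is a multiple of \<open>y\<close> on \<open>S\<close>, and the power along \<open>y\<close> has a
      zero of its own, where only \<open>A x\<close> is left.\<close>
    then have d1: "d = 1" using d by simp
    then obtain j where j: "S = {j}" unfolding d_def by (metis card_1_singletonE)
    have "j \<noteq> i" using S j by auto
    define t where "t = - l x / b"
    have t: "l x + \<beta> * t = 0" using b d1 by (simp add: t_def \<beta>_def)
    have "?P (x(i := t)) = ?P (\<lambda>k. l x * (y(i := - 1 / b)) k)"
      by (rule hpoly_cong) (use a[of j] j \<open>j \<noteq> i\<close> in \<open>auto simp: T_def l_def y_def t_def\<close>)
    also have "\<dots> = l x ^ Suc d * (R * (1 + b * (- 1 / b)) ^ Suc d)"
      unfolding hpoly_scale y_def line ..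
    also have "\<dots> = 0" using b by simp
    finally show ?thesis using PA[of x t] t by simp
  qed
  \<comment> \<open>The formula is known where the variables in \<open>S\<close> are positive; adding a large multiple of
    \<open>(1, \<dots>, 1)\<close> to \<open>x\<close> leads there.\<close>
  define p where "p = hline T (Suc d) c x (\<lambda>_. 1)"
  define q where "q = smult (inverse (\<beta> * Suc d)) ([:l x + \<beta> * x i, l (\<lambda>_. 1) + \<beta>:] ^ Suc d)"
  define m where "m = Max (insert 0 ((\<lambda>j. - x j) ` S))"
  have "p = q"
  proof (rule poly_eqI_infinite[of "{m<..}"])
    show "infinite {m<..}" by (rule infinite_Ioi)
    fix s assume s: "s \<in> {m<..}"
    have pos: "x j + s > 0" if "j \<in> S" for j
    proof -
      have "- x j \<le> m" unfolding m_def using S that by (intro Max_ge) auto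
      with s show ?thesis by auto
    qed
    have "(\<lambda>j. x j + s) = (\<lambda>j. x j + s)(i := x i + s)" by auto
    then have "poly p s = ?P ((\<lambda>j. x j + s)(i := x i + s))" by (simp add: p_def)
    also have "\<dots> = (l (\<lambda>j. x j + s) + \<beta> * (x i + s)) ^ Suc d / (\<beta> * Suc d)"
      using PA A0[of "\<lambda>j. x j + s"] pos by simp
    also have "l (\<lambda>j. x j + s) + \<beta> * (x i + s) = l x + \<beta> * x i + s * (l (\<lambda>_. 1) + \<beta>)"
      by (simp add: l_def sum.distrib distrib_left sum_distrib_left mult_ac)
    finally show "poly p s = poly q s"
      by (simp add: q_def divide_inverse mult_ac del: power_Suc)
  qed
  then have "poly p 0 = poly q 0" by simp
  then show ?thesis
    by (simp add: p_def q_def l_def \<beta>_def divide_inverse mult_ac del: power_Suc)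
qed

text \<open>
  The value of \<open>C\<close> is part of the induction: it shows that the slice attains its capacity bound at the
  point \<open>y\<^sub>j = 1 / a\<^sub>j\<close>, where the linear form has equal terms.
\<close>

theorem mixed_coeff_eq_capacity:
  assumes "finite S" "S \<noteq> {}" "hstable S (card S) c" "C > 0"
    "\<And>x. (\<And>j. j \<in> S \<Longrightarrow> x j > 0) \<Longrightarrow> hpoly S (card S) c x \<ge> C * (\<Prod>j\<in>S. x j)"
    "c (ones S) = fact (card S) / real (card S) ^ card S * C"
  shows "\<exists>a. (\<forall>j\<in>S. a j > 0) \<and> C = real (card S) ^ card S * (\<Prod>j\<in>S. a j) \<and>
    (\<forall>x. hpoly S (card S) c x = (\<Sum>j\<in>S. a j * x j) ^ card S)"
  using assms
proof (induction S arbitrary: c C rule: finite_ne_induct)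
  case (singleton i)
  have "exps {i} 1 = {ones {i}}" by (auto simp: exps_def ones_def)
  then have "hpoly {i} 1 c x = C * x i" for x
    using singleton.prems by (simp add: hpoly_def ones_def)
  then show ?case using singleton.prems by (intro exI[of _ "\<lambda>_. C"]) simp
next
  case (insert i S)
  define d where "d = card S"
  let ?T = "insert i S" and ?C = "(real d / real (Suc d)) ^ d * C"
  have d: "d > 0" using insert.hyps by (simp add: d_def card_gt_0_iff)
  have k: "card ?T = Suc d" and T: "finite ?T" "i \<in> ?T" and Si: "?T - {i} = S"
    using insert.hyps by (auto simp: d_def)
  have c: "hstable ?T (Suc d) c" using insert.prems(1) by (simp add: k)
  note ge = insert.prems(3)[unfolded k]
  have C': "?C > 0" using insert.prems(2) d by simp
  have "\<exists>a. (\<forall>j\<in>S. a j > 0) \<and> ?C = real (card S) ^ card S * (\<Prod>j\<in>S. a j) \<and>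
      (\<forall>x. hpoly S (card S) (slice i c) x = (\<Sum>j\<in>S. a j * x j) ^ card S)"
  proof (rule insert.IH)
    show "hstable S (card S) (slice i c)"
      using hstable_capacity_slice[OF T c insert.prems(2) ge] by (simp only: Si d_def)
    show "hpoly S (card S) (slice i c) x \<ge> ?C * (\<Prod>j\<in>S. x j)" if "\<And>j. j \<in> S \<Longrightarrow> x j > 0" for x
      using capacity_slice_bound(1)[OF T c less_imp_le[OF insert.prems(2)] ge, of x] that
      by (simp only: Si d_def)
    show "slice i c (ones S) = fact (card S) / real (card S) ^ card S * ?C"
      using insert.prems(4) slice_ones[OF T(2), of c]
      unfolding k fact_div_power_Suc Si d_def by (simp only: mult.assoc)
  qed (fact C')
  then obtain a where a: "\<And>j. j \<in> S \<Longrightarrow> a j > 0" and Ca: "?C = real d ^ d * (\<Prod>j\<in>S. a j)"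
    and sl: "\<And>x. hpoly S d (slice i c) x = (\<Sum>j\<in>S. a j * x j) ^ d"
    unfolding d_def by blast
  define y where "y = (\<lambda>j. inverse (a j))"
  have y: "y j > 0" if "j \<in> ?T - {i}" for j using a that by (auto simp: y_def)
  have "a j * y j = 1" if "j \<in> S" for j using a[OF that] by (simp add: y_def)
  then have "hpoly S d (slice i c) y = real d ^ d" unfolding sl by (simp add: d_def)
  also have "\<dots> = ?C * (\<Prod>j\<in>S. y j)"
  proof -
    have "(\<Prod>j\<in>S. a j) * (\<Prod>j\<in>S. y j) = 1"
      using \<open>\<And>j. j \<in> S \<Longrightarrow> a j * y j = 1\<close> by (simp flip: prod.distrib)
    then show ?thesis unfolding Ca by (simp only: mult.assoc mult_1_right)
  qed
  finally have eq: "hpoly (?T - {i}) d (slice i c) y = ?C * (\<Prod>j\<in>?T - {i}. y j)" by (simp only: Si)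
  obtain R b where b: "b > 0" and line: "\<And>t. hpoly ?T (Suc d) c (y(i := t)) = R * (1 + b * t) ^ Suc d"
    using capacity_slice_bound(2)[OF T c less_imp_le[OF insert.prems(2)] ge y eq insert.prems(2) d] by blast
  have P: "hpoly ?T (Suc d) c x = ((\<Sum>j\<in>S. a j * x j) + b * d * x i) ^ Suc d / (b * d * Suc d)" for x
    using power_linear_if_slice_power[OF insert.hyps(1,3,2), of c a b R x] c a sl b line by (simp add: d_def y_def)
  \<comment> \<open>The common factor that turns the constant in front of the power into \<open>1\<close>.\<close>
  define \<kappa> where "\<kappa> = root (Suc d) (inverse (b * d * Suc d))"
  have pos: "inverse (b * d * Suc d) > 0" using b d by simp
  have \<kappa>: "\<kappa> > 0" "\<kappa> ^ Suc d = inverse (b * d * Suc d)"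
    using pos by (simp_all only: \<kappa>_def real_root_gt_zero real_root_pow_pos zero_less_Suc)
  define a' where "a' = (\<lambda>j. \<kappa> * (if j = i then b * d else a j))"
  have S': "(\<Sum>j\<in>?T. a' j * x j) = \<kappa> * ((\<Sum>j\<in>S. a j * x j) + b * d * x i)" for x
  proof -
    have "(\<Sum>j\<in>S. a' j * x j) = (\<Sum>j\<in>S. \<kappa> * (a j * x j))"
      using insert.hyps by (intro sum.cong) (auto simp: a'_def)
    then show ?thesis using insert.hyps by (simp add: a'_def distrib_left sum_distrib_left mult_ac)
  qed
  have "hpoly ?T (Suc d) c x = (\<Sum>j\<in>?T. a' j * x j) ^ Suc d" for x
    unfolding S' power_mult_distrib \<kappa>(2) P by (simp only: divide_inverse mult.commute)
  moreover have "a' j > 0" if "j \<in> ?T" for j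
    using that a b d \<kappa> insert.hyps by (auto simp: a'_def)
  moreover have "C = real (Suc d) ^ Suc d * (\<Prod>j\<in>?T. a' j)"
  proof -
    have "(\<Prod>j\<in>S. a' j) = \<kappa> ^ d * (\<Prod>j\<in>S. a j)"
    proof -
      have "(\<Prod>j\<in>S. a' j) = (\<Prod>j\<in>S. \<kappa> * a j)"
        using insert.hyps by (intro prod.cong) (auto simp: a'_def)
      then show ?thesis by (simp add: prod.distrib d_def)
    qed
    then have "(\<Prod>j\<in>?T. a' j) = \<kappa> ^ Suc d * (b * d) * (\<Prod>j\<in>S. a j)"
      using insert.hyps by (simp add: a'_def mult_ac)
    also have "\<dots> = (\<Prod>j\<in>S. a j) / Suc d" unfolding \<kappa>(2) using b d by (simp add: field_simps del: of_nat_Suc)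
    finally have "real (Suc d) ^ Suc d * (\<Prod>j\<in>?T. a' j) = real (Suc d) ^ d * (\<Prod>j\<in>S. a j)"
      by (simp del: of_nat_Suc)
    also have "\<dots> = C"
    proof -
      have "real d ^ d * C = real d ^ d * (real (Suc d) ^ d * (\<Prod>j\<in>S. a j))"
        using Ca by (simp add: power_divide field_simps del: of_nat_Suc)
      then show ?thesis using d by (simp del: of_nat_Suc)
    qed
    finally show ?thesis ..
  qed
  ultimately show ?case unfolding k by blast
qed

section \<open>Hyperbolic polynomials are stable\<close>

text \<open>
  The hypotheses are hyperbolicity in the direction \<open>(1, \<dots>, 1)\<close> and the inclusion of the nonnegative
  orthant in the closed cone, expressed by the roots themselves.
\<close>

context
  fixes c :: "('a \<Rightarrow> nat) \<Rightarrow> real" and S :: "'a set" and d :: nat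
  assumes S: "finite S"
    and e_pos: "hpoly S d c (\<lambda>_. 1) > 0"
    and e_hyp: "\<And>x z. chpoly S d c (\<lambda>i. of_real (x i) - z) = 0 \<Longrightarrow> z \<in> \<real>"
    and cone: "\<And>x t. (\<And>i. i \<in> S \<Longrightarrow> x i \<ge> 0) \<Longrightarrow> hpoly S d c (\<lambda>i. x i - t) = 0 \<Longrightarrow> t \<ge> 0"
begin

text \<open>
  Subtracting a small multiple of \<open>(1, \<dots>, 1)\<close> from a positive vector leaves it in the cone, so its roots are
  positive and the polynomial does not vanish on the positive orthant; its sign is that at \<open>(1, \<dots>, 1)\<close>.
\<close>
lemma hyperbolic_pos:
  assumes x: "\<And>i. i \<in> S \<Longrightarrow> x i > 0"
  shows "hpoly S d c x > 0"
proof -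
  have nz: "hpoly S d c y \<noteq> 0" if y: "\<And>i. i \<in> S \<Longrightarrow> y i > 0" for y
  proof
    assume 0: "hpoly S d c y = 0"
    define \<epsilon> where "\<epsilon> = Min (insert 1 (y ` S))"
    have "\<epsilon> > 0" unfolding \<epsilon>_def using S y by auto
    moreover have "\<epsilon> \<le> y i" if "i \<in> S" for i unfolding \<epsilon>_def using S that by auto
    then have "- \<epsilon> \<ge> 0"
      using 0 by (intro cone[of "\<lambda>i. y i - \<epsilon>" "- \<epsilon>"]) auto
    ultimately show False by simp
  qed
  show ?thesis
  proof (rule ccontr)
    assume neg: "\<not> hpoly S d c x > 0"
    let ?f = "\<lambda>s. hpoly S d c (\<lambda>i. (1 - s) + s * x i)"
    have "\<exists>s\<ge>0. s \<le> 1 \<and> ?f s = 0"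
    proof (rule IVT2')
      show "?f 1 \<le> 0" "0 \<le> ?f 0" using neg e_pos by auto
      show "continuous_on {0..1} ?f" by (intro continuous_on_hpoly continuous_intros)
    qed simp
    then obtain s where s: "0 \<le> s" "s \<le> 1" "?f s = 0" by blast
    have "(1 - s) + s * x i > 0" if "i \<in> S" for i
    proof (cases "s = 0")
      case False
      then show ?thesis using s x[OF that] by (intro add_nonneg_pos) auto
    qed simp
    then have "?f s \<noteq> 0" by (rule nz)
    with s(3) show False by contradiction
  qed
qed

text \<open>
  Split \<open>Im z\<close> into a positive vector \<open>y\<close> and a multiple \<open>\<epsilon>\<close> of \<open>(1, \<dots>, 1)\<close>, and follow the roots \<open>t\<close> of
  \<open>\<beta> Re z + t y + \<i> \<epsilon> (1, \<dots>, 1)\<close> as \<open>\<beta>\<close> goes from \<open>0\<close> to \<open>1\<close>. At the start they lie below the real axis,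
  as the roots of \<open>y\<close> are positive, and by hyperbolicity they never meet the real axis; so \<open>t = \<i>\<close> is
  not a root for \<open>\<beta> = 1\<close>. Instead of continuity of roots the argument uses the least \<open>\<beta>\<close> at which a root is
  not below the axis: just before it, the distance of that root to all roots is bounded below.
\<close>
lemma hyperbolic_nonzero_Im:
  assumes z: "\<And>i. i \<in> S \<Longrightarrow> Im (z i) > 0"
  shows "chpoly S d c z \<noteq> 0"
proof
  assume zero: "chpoly S d c z = 0"
  define \<epsilon> where "\<epsilon> = Min (insert 1 ((\<lambda>i. Im (z i)) ` S)) / 2"
  have \<epsilon>: "\<epsilon> > 0" unfolding \<epsilon>_def using S z by auto
  define y where "y i = Im (z i) - \<epsilon>" for i
  have y: "y i > 0" if "i \<in> S" for i
  proof -
    have "2 * \<epsilon> \<le> Im (z i)" unfolding \<epsilon>_def using S that by auto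
    then show ?thesis using \<epsilon> by (simp add: y_def)
  qed
  define v where "v = (\<lambda>\<beta> t i. of_real (\<beta> * Re (z i)) + t * of_real (y i) + \<i> * of_real \<epsilon>)"
  define f where "f \<beta> t = chpoly S d c (v \<beta> t)" for \<beta> t
  \<comment> \<open>No root is real: \<open>- \<i> \<epsilon>\<close> would be a root in the direction \<open>(1, \<dots>, 1)\<close>.\<close>
  have real: "f \<beta> t \<noteq> 0" if "Im t = 0" for \<beta> t
  proof
    assume "f \<beta> t = 0"
    moreover have "v \<beta> t = (\<lambda>i. of_real (\<beta> * Re (z i) + Re t * y i) - (- \<i> * of_real \<epsilon>))"
      using that by (auto simp: v_def fun_eq_iff complex_eq_iff)
    ultimately have "- \<i> * of_real \<epsilon> \<in> \<real>" unfolding f_def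
      by (intro e_hyp[of "\<lambda>i. \<beta> * Re (z i) + Re t * y i"]) simp
    then show False using \<epsilon> by (simp add: complex_is_Real_iff)
  qed
  have start: "Im t < 0" if "f 0 t = 0" for t
  proof -
    have t0: "t \<noteq> 0" using real[of 0 0] that by auto
    let ?w = "- \<i> * of_real \<epsilon> / t"
    have "v 0 t = (\<lambda>i. t * (of_real (y i) - ?w))" using t0 by (simp add: v_def fun_eq_iff field_simps)
    then have w: "chpoly S d c (\<lambda>i. of_real (y i) - ?w) = 0"
      using that t0 by (simp add: f_def hpoly_scale)
    then have "?w \<in> \<real>" by (rule e_hyp)
    then obtain a where a: "?w = of_real a" by (elim Reals_cases)
    have "chpoly S d c (\<lambda>i. of_real (y i - a)) = 0" using w unfolding a of_real_diff .
    then have "hpoly S d c (\<lambda>i. y i - a) = 0" by (simp only: hpoly_of_real of_real_eq_0_iff)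
    then have "a \<ge> 0" by (rule cone[rotated]) (use y in \<open>auto intro: less_imp_le\<close>)
    moreover have "a \<noteq> 0" using a t0 \<epsilon> by auto
    ultimately have "a > 0" by simp
    have "t = - \<i> * of_real \<epsilon> / of_real a" using a t0 \<open>a > 0\<close> by (simp add: field_simps)
    then have "Im t = - (\<epsilon> / a)" by simp
    then show ?thesis using \<epsilon> \<open>a > 0\<close> by simp
  qed
  have v_eq: "v \<beta> t = (\<lambda>i. (of_real (\<beta> * Re (z i)) + \<i> * of_real \<epsilon>) + t * of_real (y i))" for \<beta> t
    by (simp add: v_def fun_eq_iff)
  define L where "L = chpoly S d c (\<lambda>i. of_real (y i))"
  have L: "L \<noteq> 0" unfolding L_def using hyperbolic_pos[of y] y by (simp add: hpoly_of_real)
  define K where "K = {p \<in> {0..1} \<times> UNIV. Im (snd p) \<ge> 0 \<and> f (fst p) (snd p) = 0}"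
  have "continuous_on UNIV (\<lambda>p. f (fst p) (snd p))"
    unfolding f_def v_def by (intro continuous_on_hpoly continuous_intros)
  then have "closed K"
    unfolding K_def
    by (simp add: Collect_conj_eq closed_Int closed_Times closed_Collect_le closed_Collect_eq continuous_intros)
  \<comment> \<open>Roots cannot escape to infinity, because \<open>y\<close> is not a zero.\<close>
  moreover have "bounded K"
  proof -
    have "\<exists>M. \<forall>p\<in>K. norm (snd p) \<le> real M"
    proof (rule ccontr)
      assume "\<not> ?thesis"
      then have "\<forall>m. \<exists>p\<in>K. norm (snd p) > real (Suc m)" by (metis not_le)
      then obtain p where p: "\<And>m. p m \<in> K" "\<And>m. norm (snd (p m)) > real (Suc m)" by metis
      define g where "g m i = of_real (y i) + (of_real (fst (p m) * Re (z i)) + \<i> * of_real \<epsilon>) / snd (p m)" for m i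
      have g0: "chpoly S d c (g m) = 0" for m
      proof -
        have "snd (p m) \<noteq> 0" using p(2)[of m] by auto
        then have "v (fst (p m)) (snd (p m)) = (\<lambda>i. snd (p m) * g m i)"
          by (simp add: v_eq g_def fun_eq_iff field_simps)
        moreover have "f (fst (p m)) (snd (p m)) = 0" using p(1)[of m] by (simp add: K_def)
        ultimately show ?thesis using \<open>snd (p m) \<noteq> 0\<close> by (simp add: f_def hpoly_scale)
      qed
      have "(\<lambda>m. g m i) \<longlonglongrightarrow> of_real (y i) + 0" for i
        unfolding g_def
      proof (rule tendsto_add[OF tendsto_const Lim_null_comparison])
        show "\<forall>\<^sub>F m in sequentially. norm ((of_real (fst (p m) * Re (z i)) + \<i> * of_real \<epsilon>) / snd (p m))
            \<le> (\<bar>Re (z i)\<bar> + \<epsilon>) * inverse (real (Suc m))"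
        proof (rule always_eventually, rule allI)
          fix m
          have "\<bar>fst (p m) * Re (z i)\<bar> \<le> \<bar>Re (z i)\<bar>"
            using p(1)[of m] by (auto simp: K_def abs_mult intro: mult_left_le_one_le)
          then have "norm (of_real (fst (p m) * Re (z i)) + \<i> * of_real \<epsilon>) \<le> \<bar>Re (z i)\<bar> + \<epsilon>"
            using \<epsilon> by (intro order.trans[OF norm_triangle_ineq]) (simp add: norm_mult abs_mult)
          moreover have "inverse (norm (snd (p m))) \<le> inverse (real (Suc m))"
            using p(2)[of m] by (intro le_imp_inverse_le) auto
          ultimately show "norm ((of_real (fst (p m) * Re (z i)) + \<i> * of_real \<epsilon>) / snd (p m))
              \<le> (\<bar>Re (z i)\<bar> + \<epsilon>) * inverse (real (Suc m))"
            unfolding norm_divide unfolding divide_inverse using \<epsilon> by (intro mult_mono) auto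
        qed
        show "(\<lambda>m. (\<bar>Re (z i)\<bar> + \<epsilon>) * inverse (real (Suc m))) \<longlonglongrightarrow> 0"
          by (rule tendsto_mult_right_zero[OF LIMSEQ_inverse_real_of_nat])
      qed
      then have "(\<lambda>m. chpoly S d c (g m)) \<longlonglongrightarrow> L" unfolding L_def by (intro tendsto_hpoly) simp
      then show False using L by (simp add: g0 LIMSEQ_const_iff)
    qed
    then obtain M where M: "\<And>p. p \<in> K \<Longrightarrow> norm (snd p) \<le> real M" by blast
    have "K \<subseteq> {0..1} \<times> cball 0 (real M)" using M by (fastforce simp: K_def)
    then show ?thesis by (rule bounded_subset[rotated]) (intro bounded_Times bounded_closed_interval bounded_cball)
  qed
  ultimately have "compact K" by (simp add: compact_eq_bounded_closed)
  then have "compact (fst ` K)" by (intro compact_continuous_image continuous_intros)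
  moreover have "(1, \<i>) \<in> K"
  proof -
    have "v 1 \<i> = z" by (auto simp: v_def y_def complex_eq_iff)
    then show ?thesis using zero by (simp add: K_def f_def)
  qed
  then have "fst ` K \<noteq> {}" by blast
  ultimately obtain \<beta> where \<beta>: "\<beta> \<in> fst ` K" "\<And>b. b \<in> fst ` K \<Longrightarrow> \<beta> \<le> b"
    using compact_attains_inf[of "fst ` K"] by blast
  then obtain t where t: "(\<beta>, t) \<in> K" by auto
  then have \<beta>01: "0 \<le> \<beta>" "\<beta> \<le> 1" and Imt: "Im t \<ge> 0" and ft: "f \<beta> t = 0" by (auto simp: K_def)
  have "\<beta> \<noteq> 0" using start[of t] ft Imt by auto
  have "Im t \<noteq> 0" using real[of t \<beta>] ft by auto
  have low: "norm (f b t) \<ge> norm L * Im t ^ d" if b: "0 \<le> b" "b < \<beta>" for b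
  proof -
    let ?p = "hline S d (\<lambda>\<alpha>. complex_of_real (c \<alpha>)) (\<lambda>i. of_real (b * Re (z i)) + \<i> * of_real \<epsilon>) (\<lambda>i. of_real (y i))"
    note p = degree_hline_eq[OF S L[unfolded L_def], of "\<lambda>i. of_real (b * Re (z i)) + \<i> * of_real \<epsilon>"]
    have pf: "poly ?p u = f b u" for u by (simp add: f_def v_eq)
    have neg: "Im u < 0" if "poly ?p u = 0" for u
    proof (rule ccontr)
      assume "\<not> Im u < 0"
      moreover have "f b u = 0" using that by (simp only: pf)
      ultimately have "(b, u) \<in> K" using b \<beta>01 by (simp add: K_def)
      then have "\<beta> \<le> b" using \<beta>(2)[of b] by (metis fst_conv image_eqI)
      with b show False by simp
    qed
    have "norm (lead_coeff ?p) * Im t ^ degree ?p \<le> norm (poly ?p t)"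
      by (rule norm_poly_ge_Im[OF p(3) _ Imt]) (rule neg)
    then show ?thesis unfolding p(2) unfolding pf p(1) L_def .
  qed
  have "((\<lambda>b. norm (f b t)) \<longlongrightarrow> norm (f \<beta> t)) (at_left \<beta>)"
    unfolding f_def v_def by (rule tendsto_norm, rule tendsto_hpoly) (intro tendsto_intros)
  moreover have "\<forall>\<^sub>F b in at_left \<beta>. norm L * Im t ^ d \<le> norm (f b t)"
  proof -
    have "\<forall>\<^sub>F b in at_left \<beta>. b \<in> {0<..<\<beta>}"
      using \<beta>01 \<open>\<beta> \<noteq> 0\<close> by (intro eventually_at_left_real) simp
    then show ?thesis by eventually_elim (rule low; simp)
  qed
  ultimately have "norm L * Im t ^ d \<le> norm (f \<beta> t)"
    by (rule tendsto_lowerbound) simp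
  moreover have "norm L * Im t ^ d > 0" using L Imt \<open>Im t \<noteq> 0\<close> by simp
  ultimately show False using ft by simp
qed

lemma hyperbolic_imp_hstable: "hstable S d c"
  unfolding hstable_def
proof (intro conjI allI impI)
  fix z :: "'a \<Rightarrow> complex" assume "\<forall>i\<in>S. Re (z i) > 0"
  then have "chpoly S d c (\<lambda>i. \<i> * z i) \<noteq> 0" by (intro hyperbolic_nonzero_Im) simp
  then show "chpoly S d c z \<noteq> 0" by (simp add: hpoly_scale)
next
  fix x :: "'a \<Rightarrow> real" assume "\<forall>i\<in>S. x i > 0"
  then show "hpoly S d c x > 0" by (intro hyperbolic_pos) blast
qed

end

lemma P_hyperbolic_hstable:
  fixes q :: "real ^ 'n::finite \<Rightarrow> real"
  assumes q: "P_hyperbolic q"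
  obtains c where "hstable UNIV CARD('n) c" "q = (\<lambda>x. hpoly UNIV CARD('n) c (($) x))"
proof -
  let ?n = "CARD('n)" and ?e = "\<chi> i. 1 :: real ^ 'n"
  have hyp: "homogeneous_poly ?n q" "q ?e > 0"
    "\<And>x. line_poly q ?e x \<noteq> 0" "\<And>x. size (proots (line_poly q ?e x)) = ?n"
    and cone: "\<And>x. (\<And>i. x $ i \<ge> 0) \<Longrightarrow> hyp_root ?e q ?n x \<ge> 0"
    using q by (auto simp: P_hyperbolic_def hyperbolic_def nonneg_cone_def)
  obtain c where "\<And>x. q x = (\<Sum>\<alpha> | sum \<alpha> UNIV = ?n. c \<alpha> * (\<Prod>i\<in>UNIV. (x $ i) ^ \<alpha> i))"
    using hyp(1) unfolding homogeneous_poly_def by blast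
  then have c: "q x = hpoly UNIV ?n c (($) x)" for x by (simp add: hpoly_def exps_UNIV)
  have line: "line_poly q ?e x = hline UNIV ?n c (($) x) (\<lambda>_. - 1)" for x
  proof (rule poly_eqI_infinite[OF infinite_UNIV_char_0])
    fix t
    have "poly (line_poly q ?e x) t = hpoly UNIV ?n c (($) (x - t *\<^sub>R ?e))"
      using poly_line_poly[OF hyp(1)] c by simp
    also have "\<dots> = poly (hline UNIV ?n c (($) x) (\<lambda>_. - 1)) t"
      unfolding poly_hline by (rule hpoly_cong) auto
    finally show "poly (line_poly q ?e x) t = poly (hline UNIV ?n c (($) x) (\<lambda>_. - 1)) t" .
  qed
  have "hstable UNIV ?n c"
  proof (rule hyperbolic_imp_hstable)
    have "($) ?e = (\<lambda>_. 1)" by auto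
    then show "hpoly UNIV ?n c (\<lambda>_. 1) > 0" using hyp(2) unfolding c by simp
  next
    fix x :: "'n \<Rightarrow> real" and z
    assume z: "chpoly UNIV ?n c (\<lambda>i. of_real (x i) - z) = 0"
    define X :: "real ^ 'n" where "X = (\<chi> i. x i)"
    have X: "($) X = x" by (auto simp: X_def)
    let ?r = "hline UNIV ?n c x (\<lambda>_. - 1)"
    have r: "?r \<noteq> 0" "size (proots ?r) = ?n" using hyp(3,4)[of X] by (simp_all add: line X)
    then have "size (proots ?r) = degree ?r"
      using size_proots_le[of ?r] degree_hline[of UNIV ?n c x "\<lambda>_. - 1"] by simp
    moreover have "poly (map_poly of_real ?r) z = 0"
      using z by (simp flip: hline_of_real)
    ultimately obtain a where "z = of_real a" using real_poly_split_complex_root[OF r(1)] by blast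
    then show "z \<in> \<real>" by simp
  next
    fix x :: "'n \<Rightarrow> real" and t
    assume x: "\<And>i. i \<in> UNIV \<Longrightarrow> x i \<ge> 0" and t: "hpoly UNIV ?n c (\<lambda>i. x i - t) = 0"
    define X :: "real ^ 'n" where "X = (\<chi> i. x i)"
    have X: "($) X = x" by (auto simp: X_def)
    let ?M = "proots (line_poly q ?e X)"
    let ?xs = "sorted_list_of_multiset ?M"
    have "poly (line_poly q ?e X) t = 0" using t by (simp add: line X)
    then have "t \<in> set ?xs" using hyp(3)[of X] by simp
    moreover have len: "length ?xs = ?n" using hyp(4)[of X] by (metis mset_sorted_list_of_multiset size_mset)
    ultimately obtain k where k: "k < ?n" "t = ?xs ! k" by (metis in_set_conv_nth)
    have "0 \<le> hyp_root ?e q ?n X" using x by (intro cone) (simp add: X_def)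
    also have "hyp_root ?e q ?n X = ?xs ! 0"
      unfolding hyp_root_def using len by (subst rev_nth) auto
    also have "\<dots> \<le> ?xs ! k" using k len by (intro sorted_nth_mono) auto
    finally show "t \<ge> 0" by (simp add: k)
  qed simp
  then show ?thesis using c that by blast
qed

section \<open>The mixed derivative and the capacity\<close>

lemma mixed_partial_hpoly:
  fixes q :: "real ^ 'n::finite \<Rightarrow> real"
  assumes "q = (\<lambda>x. hpoly UNIV (d + length vs) c (($) x))"
  shows "mixed_partial vs q = (\<lambda>x. hpoly UNIV d (foldr pd_coeffs vs c) (($) x))"
  using assms
proof (induction vs arbitrary: d)
  case Nil
  then show ?case by (simp add: mixed_partial_def)
next
  case (Cons i vs)
  have IH: "mixed_partial vs q = (\<lambda>x. hpoly UNIV (Suc d) (foldr pd_coeffs vs c) (($) x))"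
    using Cons.prems by (intro Cons.IH) simp
  have "deriv (\<lambda>t. hpoly UNIV (Suc d) (foldr pd_coeffs vs c) (($) (x + t *\<^sub>R axis i 1))) 0
      = hpoly UNIV d (foldr pd_coeffs (i # vs) c) (($) x)" for x :: "real ^ 'n"
  proof (rule DERIV_imp_deriv)
    have "(\<Sum>j\<in>UNIV. axis i 1 $ j * hpoly UNIV d (pd_coeffs j (foldr pd_coeffs vs c)) (($) x))
        = hpoly UNIV d (foldr pd_coeffs (i # vs) c) (($) x)"
      by (simp add: axis_def if_distrib if_distribR cong: if_cong)
    moreover have "($) (x + t *\<^sub>R axis i 1) = (\<lambda>j. x $ j + t * axis i 1 $ j)" for t by auto
    ultimately show "((\<lambda>t. hpoly UNIV (Suc d) (foldr pd_coeffs vs c) (($) (x + t *\<^sub>R axis i 1)))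
        has_field_derivative hpoly UNIV d (foldr pd_coeffs (i # vs) c) (($) x)) (at 0)"
      using hpoly_has_field_derivative[of UNIV d "foldr pd_coeffs vs c" "($) x" "($) (axis i 1)"] by simp
  qed
  then show ?case
    using IH by (simp add: mixed_partial_def partial_deriv_def fun_eq_iff)
qed

lemma mixed_partial_eq_coeff:
  fixes q :: "real ^ 'n::finite \<Rightarrow> real"
  assumes vars: "distinct vars" "set vars = UNIV"
    and q: "q = (\<lambda>x. hpoly UNIV CARD('n) c (($) x))"
  shows "mixed_partial vars q 0 = c (ones UNIV)"
proof -
  have "length vars = CARD('n)" using vars by (metis distinct_card)
  then have "mixed_partial vars q 0 = foldr pd_coeffs vars c (\<lambda>_. 0)"
    using mixed_partial_hpoly[of q 0 vars c] q by (simp add: hpoly_degree_0)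
  also have "\<dots> = c (ones UNIV)" using vars by (subst foldr_pd_coeffs) (auto simp: ones_def)
  finally show ?thesis .
qed

lemma partial_deriv_power_linear:
  fixes a :: "real ^ 'n::finite"
  shows "partial_deriv i (\<lambda>x. K * (\<Sum>j\<in>UNIV. a $ j * x $ j) ^ Suc d)
    = (\<lambda>x. K * a $ i * real (Suc d) * (\<Sum>j\<in>UNIV. a $ j * x $ j) ^ d)"
proof
  fix x :: "real ^ 'n"
  let ?l = "\<Sum>j\<in>UNIV. a $ j * x $ j"
  have "(\<Sum>j\<in>UNIV. a $ j * axis i 1 $ j) = a $ i"
    by (simp add: axis_def if_distrib cong: if_cong)
  then have "(\<Sum>j\<in>UNIV. a $ j * (x + t *\<^sub>R axis i 1) $ j) = ?l + t * a $ i" for t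
    by (simp add: distrib_left sum.distrib mult.left_commute flip: sum_distrib_left)
  then show "partial_deriv i (\<lambda>x. K * (\<Sum>j\<in>UNIV. a $ j * x $ j) ^ Suc d) x
      = K * a $ i * real (Suc d) * ?l ^ d"
    unfolding partial_deriv_def
    by (intro DERIV_imp_deriv) (auto intro!: derivative_eq_intros simp del: power_Suc)
qed

lemma mixed_partial_power_linear:
  fixes a :: "real ^ 'n::finite"
  shows "mixed_partial vs (\<lambda>x. K * (\<Sum>j\<in>UNIV. a $ j * x $ j) ^ (d + length vs))
    = (\<lambda>x. K * (\<Prod>i\<leftarrow>vs. a $ i) * (fact (d + length vs) / fact d) * (\<Sum>j\<in>UNIV. a $ j * x $ j) ^ d)"
proof (induction vs arbitrary: d)
  case Nil
  then show ?case by (simp add: mixed_partial_def)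
next
  case (Cons i vs)
  have "mixed_partial (i # vs) (\<lambda>x. K * (\<Sum>j\<in>UNIV. a $ j * x $ j) ^ (d + length (i # vs)))
      = partial_deriv i (mixed_partial vs (\<lambda>x. K * (\<Sum>j\<in>UNIV. a $ j * x $ j) ^ (Suc d + length vs)))"
    by (simp add: mixed_partial_def)
  also have "\<dots> = (\<lambda>x. K * (\<Prod>i\<leftarrow>vs. a $ i) * (fact (Suc d + length vs) / fact (Suc d)) * a $ i
      * real (Suc d) * (\<Sum>j\<in>UNIV. a $ j * x $ j) ^ d)"
    unfolding Cons.IH by (rule partial_deriv_power_linear)
  also have "\<dots> = (\<lambda>x. K * (\<Prod>i\<leftarrow>i # vs. a $ i) * (fact (d + length (i # vs)) / fact d)
      * (\<Sum>j\<in>UNIV. a $ j * x $ j) ^ d)"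
  proof -
    have "fact (Suc d + length vs) / fact (Suc d) * real (Suc d) = fact (d + length (i # vs)) / fact d"
      by (simp add: divide_simps del: of_nat_Suc)
    from this[symmetric] show ?thesis by (simp only: prod_list.Cons list.map) (simp only: mult_ac)
  qed
  finally show ?case .
qed

lemma mixed_partial_linear_form_power:
  fixes a :: "real ^ 'n::finite"
  assumes vars: "distinct vars" "set vars = UNIV"
  shows "mixed_partial vars (linear_form_power a) 0 = fact CARD('n) / real CARD('n) ^ CARD('n) * (\<Prod>i\<in>UNIV. a $ i)"
proof -
  let ?n = "CARD('n)"
  have len: "length vars = ?n" using vars by (metis distinct_card)
  have "linear_form_power a = (\<lambda>x. inverse (real ?n ^ ?n) * (\<Sum>j\<in>UNIV. a $ j * x $ j) ^ (0 + length vars))"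
    unfolding linear_form_power_def len add_0 power_divide by (simp add: divide_inverse mult.commute)
  then have "mixed_partial vars (linear_form_power a) 0 = inverse (real ?n ^ ?n) * (\<Prod>i\<leftarrow>vars. a $ i) * fact ?n"
    by (simp only: mixed_partial_power_linear) (simp add: len)
  also have "(\<Prod>i\<leftarrow>vars. a $ i) = (\<Prod>i\<in>UNIV. a $ i)"
    using prod.distinct_set_conv_list[OF vars(1), of "\<lambda>i. a $ i"] vars(2) by simp
  finally show ?thesis by (simp add: divide_inverse mult_ac)
qed

text \<open>
  The infimum is attained where all terms \<open>a\<^sub>i x\<^sub>i\<close> agree; that it is a lower bound is the inequality of
  arithmetic and geometric means.
\<close>

lemma capacity_linear_form_power:
  fixes a :: "real ^ 'n::finite"
  assumes a: "\<And>i. a $ i > 0"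
  shows "capacity (linear_form_power a) = (\<Prod>i\<in>UNIV. a $ i)"
  unfolding capacity_def
proof (rule cInf_eq_minimum)
  let ?n = "CARD('n)" and ?A = "\<Prod>i\<in>UNIV. a $ i"
  have A: "?A > 0" using a by (intro prod_pos) auto
  define g where "g = root ?n ?A"
  have g: "g > 0" "g ^ ?n = ?A" using A by (auto simp: g_def)
  define x :: "real ^ 'n" where "x = (\<chi> i. g / a $ i)"
  have "(\<Prod>i\<in>UNIV. x $ i) = 1"
    using g A less_imp_neq[OF a] by (simp add: x_def prod_dividef)
  moreover have "a $ i * x $ i = g" for i using a[of i] by (simp add: x_def)
  then have "linear_form_power a x = ?A" by (simp add: linear_form_power_def g)
  moreover have "\<forall>i. x $ i > 0" using a g by (simp add: x_def)
  ultimately show "?A \<in> {linear_form_power a x |x. (\<forall>i. 0 < x $ i) \<and> (\<Prod>i\<in>UNIV. x $ i) = 1}"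
    by (intro CollectI exI[of _ x]) simp
next
  let ?n = "CARD('n)" and ?A = "\<Prod>i\<in>UNIV. a $ i"
  fix v assume "v \<in> {linear_form_power a x |x. (\<forall>i. 0 < x $ i) \<and> (\<Prod>i\<in>UNIV. x $ i) = 1}"
  then obtain x :: "real ^ 'n" where v: "v = linear_form_power a x" and x: "\<And>i. x $ i > 0" "(\<Prod>i\<in>UNIV. x $ i) = 1"
    by blast
  define M where "M = (\<Sum>i\<in>UNIV. a $ i * x $ i) / real ?n"
  have M: "M > 0" unfolding M_def using a x by (intro divide_pos_pos sum_pos) auto
  have "(\<Prod>i\<in>UNIV. a $ i * x $ i / M) \<le> 1"
  proof (rule prod_le_one_if_sum_eq_card(1))
    have "(\<Sum>i\<in>UNIV. a $ i * x $ i) = real ?n * M" by (simp add: M_def)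
    then show "(\<Sum>i\<in>UNIV. a $ i * x $ i / M) = ?n" using M by (simp flip: sum_divide_distrib)
    show "a $ i * x $ i / M \<ge> 0" for i using a[of i] x(1)[of i] M by simp
  qed simp
  then have "?A / M ^ ?n \<le> 1" by (simp add: prod_dividef prod.distrib x(2))
  then have "?A \<le> M ^ ?n" using M by simp
  then show "?A \<le> v" by (simp add: v linear_form_power_def M_def)
qed

text \<open>
  Dividing a positive vector by the geometric mean of its entries brings it into the set over which the
  infimum is taken.
\<close>

lemma capacity_bound:
  fixes q :: "real ^ 'n::finite \<Rightarrow> real"
  assumes c: "hstable UNIV CARD('n) c" and q: "q = (\<lambda>x. hpoly UNIV CARD('n) c (($) x))"
  shows "capacity q \<ge> 0"
    and "\<And>x. (\<And>i. x i > 0) \<Longrightarrow> hpoly UNIV CARD('n) c x \<ge> capacity q * (\<Prod>i\<in>UNIV. x i)"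
proof -
  let ?n = "CARD('n)"
  let ?V = "{q x | x. (\<forall>i. x $ i > 0) \<and> (\<Prod>i\<in>UNIV. x $ i) = 1}"
  have pos: "v \<ge> 0" if "v \<in> ?V" for v
    using that hstable_pos[OF c] by (auto simp: q intro: less_imp_le)
  have "q (\<chi> i. 1) \<in> ?V" by force
  then have "?V \<noteq> {}" by blast
  then show "capacity q \<ge> 0" unfolding capacity_def using pos by (rule cInf_greatest)
  have bdd: "bdd_below ?V" using pos by (rule bdd_belowI)
  fix x :: "'n \<Rightarrow> real" assume x: "\<And>i. x i > 0"
  define p where "p = (\<Prod>i\<in>UNIV. x i)"
  have p: "p > 0" unfolding p_def using x by (intro prod_pos) auto
  define g where "g = root ?n p"
  have g: "g > 0" "g ^ ?n = p" using p by (auto simp: g_def)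
  define y :: "real ^ 'n" where "y = (\<chi> i. x i / g)"
  have "(\<Prod>i\<in>UNIV. y $ i) = 1" using g p less_imp_neq[OF x] by (simp add: y_def prod_dividef p_def)
  moreover have "\<forall>i. y $ i > 0" using x g by (simp add: y_def)
  ultimately have "q y \<in> ?V" by blast
  then have cap: "capacity q \<le> q y" unfolding capacity_def by (rule cInf_lower[OF _ bdd])
  have "x = (\<lambda>i. g * y $ i)" using g by (simp add: y_def)
  then have "hpoly UNIV ?n c x = p * q y" by (simp add: hpoly_scale g q)
  then show "hpoly UNIV ?n c x \<ge> capacity q * (\<Prod>i\<in>UNIV. x i)"
    using cap p by (simp add: p_def mult.commute mult_left_mono)
qed

theorem theorem2p1:
  fixes vars :: "'n::finite list"
  assumes vars: "distinct vars" "set vars = UNIV"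
  shows "(\<forall>q :: real ^ 'n \<Rightarrow> real. P_hyperbolic q \<longrightarrow>
            mixed_partial vars q 0 \<ge> fact CARD('n) / real CARD('n) ^ CARD('n) * capacity q) \<and>
         (\<forall>q :: real ^ 'n \<Rightarrow> real. P_hyperbolic q \<and> capacity q > 0 \<longrightarrow>
            (mixed_partial vars q 0 = fact CARD('n) / real CARD('n) ^ CARD('n) * capacity q \<longleftrightarrow>
             (\<exists>a. (\<forall>i. a $ i > 0) \<and> q = linear_form_power a))) \<and>
         (\<forall>a :: real ^ 'n. (\<forall>i. a $ i > 0) \<longrightarrow>
            capacity (linear_form_power a) = (\<Prod>i\<in>UNIV. a $ i))"
proof (intro conjI allI impI)
  fix q :: "real ^ 'n \<Rightarrow> real"
  assume "P_hyperbolic q"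
  then obtain c where c: "hstable UNIV CARD('n) c" and q: "q = (\<lambda>x. hpoly UNIV CARD('n) c (($) x))"
    by (rule P_hyperbolic_hstable)
  note cap = capacity_bound[OF c q]
  show "mixed_partial vars q 0 \<ge> fact CARD('n) / real CARD('n) ^ CARD('n) * capacity q"
  proof (cases "capacity q = 0")
    case True
    then show ?thesis
      using mixed_coeff_nonneg[of UNIV c] c by (simp add: mixed_partial_eq_coeff[OF vars q])
  next
    case False
    then show ?thesis
      unfolding mixed_partial_eq_coeff[OF vars q]
      using cap c by (intro mixed_coeff_ge_capacity) auto
  qed
next
  fix q :: "real ^ 'n \<Rightarrow> real"
  assume "P_hyperbolic q \<and> capacity q > 0"
  then obtain c where c: "hstable UNIV CARD('n) c" and q: "q = (\<lambda>x. hpoly UNIV CARD('n) c (($) x))"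
    and pos: "capacity q > 0"
    using P_hyperbolic_hstable by blast
  note cap = capacity_bound[OF c q]
  show "mixed_partial vars q 0 = fact CARD('n) / real CARD('n) ^ CARD('n) * capacity q \<longleftrightarrow>
             (\<exists>a. (\<forall>i. a $ i > 0) \<and> q = linear_form_power a)"
  proof
    assume "mixed_partial vars q 0 = fact CARD('n) / real CARD('n) ^ CARD('n) * capacity q"
    then have "c (ones UNIV) = fact CARD('n) / real CARD('n) ^ CARD('n) * capacity q"
      by (simp only: mixed_partial_eq_coeff[OF vars q])
    then obtain a where a: "\<And>j. a j > 0" "\<And>x. hpoly UNIV CARD('n) c x = (\<Sum>j\<in>UNIV. a j * x j) ^ CARD('n)"
      using mixed_coeff_eq_capacity[OF finite _ c pos cap(2)] by auto
    define b :: "real ^ 'n" where "b = (\<chi> i. real CARD('n) * a i)"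
    have "q = linear_form_power b"
    proof
      fix x
      have "(\<Sum>i\<in>UNIV. b $ i * x $ i) = real CARD('n) * (\<Sum>j\<in>UNIV. a j * x $ j)"
        by (simp add: b_def sum_distrib_left mult_ac)
      then show "q x = linear_form_power b x" by (simp add: q a(2) linear_form_power_def)
    qed
    moreover have "\<forall>i. b $ i > 0" using a(1) by (simp add: b_def)
    ultimately show "\<exists>a. (\<forall>i. a $ i > 0) \<and> q = linear_form_power a" by blast
  next
    assume "\<exists>a. (\<forall>i. a $ i > 0) \<and> q = linear_form_power a"
    then obtain a :: "real ^ 'n" where "\<And>i. a $ i > 0" "q = linear_form_power a" by blast
    then show "mixed_partial vars q 0 = fact CARD('n) / real CARD('n) ^ CARD('n) * capacity q"
      using mixed_partial_linear_form_power[OF vars, of a] capacity_linear_form_power[of a] by simp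
  qed
next
  fix a :: "real ^ 'n"
  assume "\<forall>i. a $ i > 0"
  then show "capacity (linear_form_power a) = (\<Prod>i\<in>UNIV. a $ i)"
    by (intro capacity_linear_form_power) blast
qed

end
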